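(* For a time-homogeneous quantum Markov chain given by a quantum channel $\mathcal{N}\colon A\to A$, being mixing and being replacing are equivalent. Moreover, any property of the asymptotic behaviour of a homogeneous Markov chain that is implied by replacing and implies mixing, such as being decoupling, is also equivalent to them.
   Context: $A$ is finite-dimensional, $R$ ranges over all finite-dimensional reference systems, and $\mathcal{N}^n$ is the $n$-fold composition of $\mathcal{N}$. Mixing: $\mathcal{N}$ has a unique fixed-point state $\omega_A$ and $\lim_{n\to\infty}\|\mathcal{N}^n(\rho_A)-\omega_A\|_1=0$ for all states $\rho_A$. Replacing: $\lim_{n\to\infty}\|(\operatorname{id}_R\otimes\mathcal{N}^n)(\rho_{RA}-\sigma_{RA})\|_1=\|\rho_R-\sigma_R\|_1$ for all $R$ and all states $\rho_{RA},\sigma_{RA}$. Decoupling: with $\omega_A$ the fixed point of $\mathcal{N}$, $\lim_{n\to\infty}\|(\operatorname{id}_R\otimes\mathcal{N}^n)(\rho_{RA}-\rho_R\otimes\omega_A)\|_1=0$ for all $R$ and all states $\rho_{RA}$. *)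

theory Defs
  imports Complex_Main "Jordan_Normal_Form.Schur_Decomposition"
begin

text \<open>
  A finite-dimensional system of dimension \<open>d\<close> is represented, after choosing an orthonormal basis,
  by the algebra \<^term>\<open>carrier_mat d d\<close> of complex matrices.  For a bipartite system \<open>RA\<close> with
  dimensions \<open>r\<close> and \<open>d\<close>, the product basis vector with indices \<open>(k, a)\<close> has index \<open>k * d + a\<close>, so that
  an index \<open>i < r * d\<close> has \<open>R\<close>-component \<open>i div d\<close> and \<open>A\<close>-component \<open>i mod d\<close>.
\<close>

definition mat_trace :: "complex mat \<Rightarrow> complex" where
  "mat_trace X = (\<Sum>i<dim_row X. X $$ (i, i))"

text \<open>
  The order on \<^typ>\<open>complex\<close> is the one of \<^theory>\<open>HOL-Library.Complex_Order\<close>: \<open>0 \<le> z\<close> says that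
  \<open>z\<close> is real and nonnegative.  Hence Hermiticity is implied.
\<close>

definition psd :: "nat \<Rightarrow> complex mat \<Rightarrow> bool" where
  "psd n X \<longleftrightarrow> X \<in> carrier_mat n n \<and> (\<forall>v \<in> carrier_vec n. 0 \<le> (X *\<^sub>v v) \<bullet>c v)"

definition state :: "nat \<Rightarrow> complex mat \<Rightarrow> bool" where
  "state n \<rho> \<longleftrightarrow> psd n \<rho> \<and> mat_trace \<rho> = 1"

text \<open>Meant for positive semidefinite \<open>X\<close>, where the square root exists and is unique.\<close>

definition psd_sqrt :: "complex mat \<Rightarrow> complex mat" where
  "psd_sqrt X = (THE S. psd (dim_row X) S \<and> S * S = X)"

definition trace_norm :: "complex mat \<Rightarrow> real" where
  "trace_norm X = Re (mat_trace (psd_sqrt (mat_adjoint X * X)))"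

definition kron :: "complex mat \<Rightarrow> complex mat \<Rightarrow> complex mat" (infixl "\<otimes>\<^sub>K" 70) where
  "X \<otimes>\<^sub>K Y = mat (dim_row X * dim_row Y) (dim_col X * dim_col Y)
     (\<lambda>(i, j). X $$ (i div dim_row Y, j div dim_col Y) * Y $$ (i mod dim_row Y, j mod dim_col Y))"

definition ptrace_A :: "nat \<Rightarrow> nat \<Rightarrow> complex mat \<Rightarrow> complex mat" where
  "ptrace_A r d X = mat r r (\<lambda>(k, l). \<Sum>a<d. X $$ (k * d + a, l * d + a))"

definition block :: "nat \<Rightarrow> complex mat \<Rightarrow> nat \<Rightarrow> nat \<Rightarrow> complex mat" where
  "block d X k l = mat d d (\<lambda>(a, b). X $$ (k * d + a, l * d + b))"

text \<open>
  Writing \<open>X = (\<Sum>k l. E\<^sub>k\<^sub>l \<otimes> block d X k l)\<close> with the matrix units \<open>E\<^sub>k\<^sub>l\<close> of \<open>R\<close>, the map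
  \<open>id\<^sub>R \<otimes> N\<close> applies \<open>N\<close> to each block; see also \<open>id_tensor_kron\<close> below.
\<close>

definition id_tensor ::
    "nat \<Rightarrow> nat \<Rightarrow> (complex mat \<Rightarrow> complex mat) \<Rightarrow> complex mat \<Rightarrow> complex mat" where
  "id_tensor r d N X = mat (r * d) (r * d)
     (\<lambda>(i, j). N (block d X (i div d) (j div d)) $$ (i mod d, j mod d))"

definition linear_superop :: "nat \<Rightarrow> (complex mat \<Rightarrow> complex mat) \<Rightarrow> bool" where
  "linear_superop d N \<longleftrightarrow>
     (\<forall>X \<in> carrier_mat d d. N X \<in> carrier_mat d d) \<and>
     (\<forall>X \<in> carrier_mat d d. \<forall>Y \<in> carrier_mat d d. N (X + Y) = N X + N Y) \<and>
     (\<forall>c. \<forall>X \<in> carrier_mat d d. N (c \<cdot>\<^sub>m X) = c \<cdot>\<^sub>m N X)"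

definition completely_positive :: "nat \<Rightarrow> (complex mat \<Rightarrow> complex mat) \<Rightarrow> bool" where
  "completely_positive d N \<longleftrightarrow> (\<forall>r>0. \<forall>X. psd (r * d) X \<longrightarrow> psd (r * d) (id_tensor r d N X))"

definition trace_preserving :: "nat \<Rightarrow> (complex mat \<Rightarrow> complex mat) \<Rightarrow> bool" where
  "trace_preserving d N \<longleftrightarrow> (\<forall>X \<in> carrier_mat d d. mat_trace (N X) = mat_trace X)"

text \<open>The values of \<open>N\<close> outside \<^term>\<open>carrier_mat d d\<close> are irrelevant.\<close>

definition quantum_channel :: "nat \<Rightarrow> (complex mat \<Rightarrow> complex mat) \<Rightarrow> bool" where
  "quantum_channel d N \<longleftrightarrow>
     linear_superop d N \<and> completely_positive d N \<and> trace_preserving d N"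

lemma id_tensor_kron:
  assumes N: "linear_superop d N" and X: "X \<in> carrier_mat r r" and Y: "Y \<in> carrier_mat d d"
  shows "id_tensor r d N (X \<otimes>\<^sub>K Y) = X \<otimes>\<^sub>K N Y"
proof -
  have NY: "N Y \<in> carrier_mat d d" using N Y unfolding linear_superop_def by blast
  have idx: "k * d + a < r * d" if "k < r" "a < d" for k a :: nat
  proof -
    have "k * d + a < (k + 1) * d" using that by simp
    also have "\<dots> \<le> r * d" using that by (intro mult_le_mono1) simp
    finally show ?thesis .
  qed
  have block: "block d (X \<otimes>\<^sub>K Y) k l = X $$ (k, l) \<cdot>\<^sub>m Y" if "k < r" "l < r" for k l
    using X Y that by (intro eq_matI) (auto simp: block_def kron_def idx)
  show ?thesis
  proof (rule eq_matI)
    fix i j assume "i < dim_row (X \<otimes>\<^sub>K N Y)" "j < dim_col (X \<otimes>\<^sub>K N Y)"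
    then have ij: "i < r * d" "j < r * d" using X NY by (auto simp: kron_def)
    then have d: "d > 0" by (cases d) auto
    have q: "i div d < r" "j div d < r" using ij by (auto intro: less_mult_imp_div_less)
    have "N (X $$ (i div d, j div d) \<cdot>\<^sub>m Y) = X $$ (i div d, j div d) \<cdot>\<^sub>m N Y"
      using N Y unfolding linear_superop_def by blast
    then have "id_tensor r d N (X \<otimes>\<^sub>K Y) $$ (i, j) =
        (X $$ (i div d, j div d) \<cdot>\<^sub>m N Y) $$ (i mod d, j mod d)"
      using ij by (simp add: id_tensor_def block[OF q])
    then show "id_tensor r d N (X \<otimes>\<^sub>K Y) $$ (i, j) = (X \<otimes>\<^sub>K N Y) $$ (i, j)"
      using ij d X NY by (simp add: kron_def)
  qed (use X NY in \<open>auto simp: id_tensor_def kron_def\<close>)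
qed

definition unique_fixed_state ::
    "nat \<Rightarrow> (complex mat \<Rightarrow> complex mat) \<Rightarrow> complex mat \<Rightarrow> bool" where
  "unique_fixed_state d N \<omega> \<longleftrightarrow>
     state d \<omega> \<and> N \<omega> = \<omega> \<and> (\<forall>\<omega>'. state d \<omega>' \<and> N \<omega>' = \<omega>' \<longrightarrow> \<omega>' = \<omega>)"

definition mixing :: "nat \<Rightarrow> (complex mat \<Rightarrow> complex mat) \<Rightarrow> bool" where
  "mixing d N \<longleftrightarrow> (\<exists>\<omega>. unique_fixed_state d N \<omega> \<and>
     (\<forall>\<rho>. state d \<rho> \<longrightarrow> (\<lambda>n. trace_norm ((N ^^ n) \<rho> - \<omega>)) \<longlonglongrightarrow> 0))"

definition replacing :: "nat \<Rightarrow> (complex mat \<Rightarrow> complex mat) \<Rightarrow> bool" where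
  "replacing d N \<longleftrightarrow> (\<forall>r>0. \<forall>\<rho> \<sigma>. state (r * d) \<rho> \<and> state (r * d) \<sigma> \<longrightarrow>
     (\<lambda>n. trace_norm (id_tensor r d (N ^^ n) (\<rho> - \<sigma>)))
       \<longlonglongrightarrow> trace_norm (ptrace_A r d \<rho> - ptrace_A r d \<sigma>))"

definition decoupling :: "nat \<Rightarrow> (complex mat \<Rightarrow> complex mat) \<Rightarrow> bool" where
  "decoupling d N \<longleftrightarrow> (\<exists>\<omega>. unique_fixed_state d N \<omega> \<and>
     (\<forall>r>0. \<forall>\<rho>. state (r * d) \<rho> \<longrightarrow>
       (\<lambda>n. trace_norm (id_tensor r d (N ^^ n) (\<rho> - ptrace_A r d \<rho> \<otimes>\<^sub>K \<omega>))) \<longlonglongrightarrow> 0))"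

end

theory Submission
  imports Defs
begin

text \<open>
  States span all matrices, so mixing forces \<open>N\<^sup>n X\<close> to converge entrywise to \<open>tr X \<cdot> \<omega>\<close> for every
  matrix \<open>X\<close>; hence \<open>(id\<^sub>R \<otimes> N\<^sup>n) X\<close> converges to \<open>X\<^sub>R \<otimes> \<omega>\<close>, and continuity of the trace norm
  gives replacing and decoupling at once.  Conversely, replacing with trivial \<open>R\<close> says that
  \<open>N\<^sup>n Y \<rightarrow> 0\<close> for traceless \<open>Y\<close>.  Trace preservation means that the identity is a fixed point of the
  transpose of \<open>N\<close>, so \<open>N\<close> has a fixed matrix \<open>X \<noteq> 0\<close>; it cannot be traceless, and \<open>X / tr X\<close> is
  the limit of \<open>N\<^sup>n \<sigma>\<close> for every state \<open>\<sigma>\<close>, hence itself a state.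

  Continuity of the trace norm comes from the bound \<open>\<lambda>\<^sup>2 \<le> \<parallel>S\<^sup>2 - T\<^sup>2\<parallel>\<close> for every eigenvalue \<open>\<lambda>\<close> of
  \<open>S - T\<close>, where \<open>S\<close> and \<open>T\<close> are positive semidefinite; the same bound gives uniqueness of square roots.
\<close>

section \<open>Unitary diagonalization of Hermitian matrices\<close>

lemma adjoint_dim [simp]:
  "dim_row (mat_adjoint A) = dim_col A" "dim_col (mat_adjoint A) = dim_row A"
  by (simp_all add: mat_adjoint_def)

lemma adjoint_carrier [simp]: "A \<in> carrier_mat n m \<Longrightarrow> mat_adjoint A \<in> carrier_mat m n"
  by (metis adjoint_dim carrier_matD carrier_matI)

lemma adjoint_index [simp]:
  fixes A :: "complex mat"
  shows "i < dim_col A \<Longrightarrow> j < dim_row A \<Longrightarrow> mat_adjoint A $$ (i, j) = cnj (A $$ (j, i))"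
  by (simp add: mat_adjoint_def mat_of_rows_index)

lemma adjoint_adjoint [simp]: "mat_adjoint (mat_adjoint A) = (A :: complex mat)"
  by (intro eq_matI) auto

lemma mult_index:
  fixes A B :: "complex mat"
  assumes "A \<in> carrier_mat n m" "B \<in> carrier_mat m l" "i < n" "j < l"
  shows "(A * B) $$ (i, j) = (\<Sum>k<m. A $$ (i, k) * B $$ (k, j))"
  using assms by (auto simp: scalar_prod_def atLeast0LessThan)

lemma adjoint_mult:
  fixes A B :: "complex mat"
  assumes A: "A \<in> carrier_mat n m" and B: "B \<in> carrier_mat m l"
  shows "mat_adjoint (A * B) = mat_adjoint B * mat_adjoint A"
proof (rule eq_matI)
  fix i j assume "i < dim_row (mat_adjoint B * mat_adjoint A)" "j < dim_col (mat_adjoint B * mat_adjoint A)"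
  then have ij: "i < l" "j < n" using A B by auto
  then show "mat_adjoint (A * B) $$ (i, j) = (mat_adjoint B * mat_adjoint A) $$ (i, j)"
    using A B by (simp add: mult_index[OF A B] mult_index[OF adjoint_carrier[OF B] adjoint_carrier[OF A]] mult.commute
        del: index_mult_mat(1))
qed (use A B in auto)

definition unitary :: "nat \<Rightarrow> complex mat \<Rightarrow> bool" where
  "unitary n U \<longleftrightarrow> U \<in> carrier_mat n n \<and> mat_adjoint U * U = 1\<^sub>m n \<and> U * mat_adjoint U = 1\<^sub>m n"

text \<open>The diagonal is real by construction, so that a diagonalization into this form already
  records that the eigenvalues are real. Values of \<open>f\<close> from \<open>n\<close> on do not
  matter.\<close>

definition real_diag :: "nat \<Rightarrow> (nat \<Rightarrow> real) \<Rightarrow> complex mat" where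
  "real_diag n f = mat n n (\<lambda>(i, j). if i = j then complex_of_real (f i) else 0)"

lemma real_diag_carrier [simp]: "real_diag n f \<in> carrier_mat n n"
  by (simp add: real_diag_def)

text \<open>A one-sided inverse of a square matrix is two-sided.\<close>

lemma unitaryI:
  assumes U: "U \<in> carrier_mat n n" and "mat_adjoint U * U = 1\<^sub>m n"
  shows "unitary n U"
  using assms mat_mult_left_right_inverse[OF adjoint_carrier[OF U] U] by (auto simp: unitary_def)

lemma unitary_mult:
  assumes U: "unitary n U" and V: "unitary n V"
  shows "unitary n (U * V)"
proof (rule unitaryI)
  have c [simp]: "U \<in> carrier_mat n n" "V \<in> carrier_mat n n" using U V by (auto simp: unitary_def)
  show "U * V \<in> carrier_mat n n" by (rule mult_carrier_mat[OF c])
  have "mat_adjoint (U * V) * (U * V) = mat_adjoint V * ((mat_adjoint U * U) * V)"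
    by (simp add: adjoint_mult[OF c] assoc_mult_mat[of _ n n _ n _ n] mult_carrier_mat[of _ n n _ n])
  then show "mat_adjoint (U * V) * (U * V) = 1\<^sub>m n"
    using U V by (simp add: unitary_def left_mult_one_mat[OF c(2)])
qed

text \<open>The characteristic polynomial splits over the complex numbers, so an eigenvector
  \<open>v\<close> exists. Completing \<open>v\<close> to a basis, orthogonalizing and normalizing
  gives the columns of \<open>W\<close>; Gram-Schmidt leaves its first vector unchanged, so column 0
  is a multiple of \<open>v\<close>.\<close>

lemma unitary_from_eigenvector:
  fixes A :: "complex mat"
  assumes A: "A \<in> carrier_mat (Suc m) (Suc m)"
  obtains W e where "unitary (Suc m) W" "\<And>i. i < Suc m \<Longrightarrow> (A * W) $$ (i, 0) = e * W $$ (i, 0)"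
proof -
  let ?n = "Suc m"
  obtain as where as: "char_poly A = (\<Prod>a\<leftarrow>as. [:- a, 1:])" "length as = ?n"
    using char_poly_factorized[OF A] by blast
  then obtain e es where "as = e # es" by (cases as) auto
  then have "eigenvalue A e" using eigenvalue_root_char_poly[OF A] as by simp
  then obtain v where "eigenvector A v e" unfolding eigenvalue_def by blast
  then have v: "v \<in> carrier_vec ?n" "v \<noteq> 0\<^sub>v ?n" and ev: "A *\<^sub>v v = e \<cdot>\<^sub>v v"
    using A unfolding eigenvector_def by auto
  interpret cof_vec_space ?n "TYPE(complex)" .
  define b where "b = basis_completion v"
  define ws where "ws = gram_schmidt ?n b"
  have b: "distinct b" "\<not> lin_dep (set b)" "set b \<subseteq> carrier_vec ?n" "hd b = v" "length b = ?n"
    using basis_completion[OF v, folded b_def] by auto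
  then obtain vs where bv: "b = v # vs" by (cases b) auto
  have ws: "set ws \<subseteq> carrier_vec ?n" "corthogonal ws" "length ws = ?n"
    using gram_schmidt_result[OF b(3) b(1) b(2) ws_def] b by auto
  have "hd ws = v" using gram_schmidt_hd[OF v(1), of vs] by (simp add: ws_def bv)
  then have ws0: "ws ! 0 = v" using ws by (metis hd_conv_nth length_0_conv nat.distinct(1))
  have wc: "ws ! j \<in> carrier_vec ?n" if "j < ?n" for j using ws that by auto
  \<comment> \<open>The squared norms of the Gram-Schmidt vectors, which are orthogonal but not yet
    normalized.\<close>
  define q where "q j = (\<Sum>k<?n. (cmod (ws ! j $ k))\<^sup>2)" for j
  have ip: "ws ! i \<bullet>c ws ! j = (\<Sum>k<?n. ws ! i $ k * cnj (ws ! j $ k))" if "i < ?n" "j < ?n" for i j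
    using wc[OF that(1)] wc[OF that(2)] by (auto simp: scalar_prod_def atLeast0LessThan intro!: sum.cong)
  have ipq: "ws ! i \<bullet>c ws ! i = complex_of_real (q i)" if "i < ?n" for i
    unfolding ip[OF that that] q_def by (simp add: complex_norm_square del: of_real_power)
  have orth: "(ws ! i \<bullet>c ws ! j = 0) = (i \<noteq> j)" if "i < ?n" "j < ?n" for i j
    using ws that unfolding corthogonal_def by auto
  \<comment> \<open>\<open>corthogonal\<close> also excludes self-orthogonal vectors, so the norms
    by which the columns are divided do not vanish.\<close>
  have q0: "q i > 0" if "i < ?n" for i
  proof -
    have "q i \<noteq> 0" using orth[OF that that] ipq[OF that] by auto
    moreover have "q i \<ge> 0" unfolding q_def by (intro sum_nonneg) simp
    ultimately show ?thesis by simp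
  qed
  define W where "W = mat ?n ?n (\<lambda>(i, j). ws ! j $ i / complex_of_real (sqrt (q j)))"
  have W: "W \<in> carrier_mat ?n ?n" by (simp add: W_def)
  have "mat_adjoint W * W = 1\<^sub>m ?n"
  proof (rule eq_matI)
    fix i j assume "i < dim_row (1\<^sub>m ?n :: complex mat)" "j < dim_col (1\<^sub>m ?n :: complex mat)"
    then have ij: "i < ?n" "j < ?n" by auto
    have "(mat_adjoint W * W) $$ (i, j) = (\<Sum>k<?n. cnj (W $$ (k, i)) * W $$ (k, j))"
      using ij W by (simp add: mult_index[OF adjoint_carrier[OF W] W] del: index_mult_mat sum.lessThan_Suc)
    also have "\<dots> = (\<Sum>k<?n. ws ! j $ k * cnj (ws ! i $ k) / complex_of_real (sqrt (q i) * sqrt (q j)))"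
      using ij by (intro sum.cong) (auto simp: W_def field_simps)
    also have "\<dots> = (ws ! j \<bullet>c ws ! i) / complex_of_real (sqrt (q i) * sqrt (q j))"
      unfolding ip[OF ij(2) ij(1)] by (simp add: sum_divide_distrib del: sum.lessThan_Suc)
    also have "\<dots> = 1\<^sub>m ?n $$ (i, j)"
    proof (cases "i = j")
      case True
      then show ?thesis using ij q0[OF ij(1)] by (simp add: ipq del: of_real_mult)
    next
      case False
      then show ?thesis using orth[OF ij(2) ij(1)] ij by simp
    qed
    finally show "(mat_adjoint W * W) $$ (i, j) = 1\<^sub>m ?n $$ (i, j)" .
  qed (use W in auto)
  then have "unitary ?n W" by (rule unitaryI[OF W])
  moreover have "(A * W) $$ (i, 0) = e * W $$ (i, 0)" if i: "i < ?n" for i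
  proof -
    have "(A * W) $$ (i, 0) = (\<Sum>k<?n. A $$ (i, k) * v $ k) / complex_of_real (sqrt (q 0))"
      unfolding mult_index[OF A W i zero_less_Suc] sum_divide_distrib
      by (intro sum.cong) (auto simp: W_def ws0)
    also have "(\<Sum>k<?n. A $$ (i, k) * v $ k) = (A *\<^sub>v v) $ i"
      using A v i by (auto simp: scalar_prod_def atLeast0LessThan intro!: sum.cong)
    also have "(A *\<^sub>v v) $ i = e * v $ i" using ev v i by simp
    finally show ?thesis using i by (simp add: W_def ws0)
  qed
  ultimately show ?thesis by (rule that)
qed

text \<open>Induction on the dimension by deflation: in a unitary basis that starts with an
  eigenvector, a Hermitian matrix is block diagonal, and the induction hypothesis diagonalizes the
  remaining block.\<close>

lemma hermitian_spectral:
  assumes "A \<in> carrier_mat n n" and "mat_adjoint A = A"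
  shows "\<exists>U f. unitary n U \<and> mat_adjoint U * A * U = real_diag n f"
  using assms
proof (induction n arbitrary: A)
  case 0
  then show ?case by (intro exI[of _ "1\<^sub>m 0"]) (auto simp: unitary_def real_diag_def intro!: eq_matI)
next
  case (Suc m)
  let ?n = "Suc m"
  note A = Suc.prems(1)
  obtain W e where W: "unitary ?n W" and col0: "\<And>i. i < ?n \<Longrightarrow> (A * W) $$ (i, 0) = e * W $$ (i, 0)"
    using unitary_from_eigenvector[OF A] by blast
  have Wc: "W \<in> carrier_mat ?n ?n" and WW: "mat_adjoint W * W = 1\<^sub>m ?n" using W by (auto simp: unitary_def)
  note Wa = adjoint_carrier[OF Wc]
  define B where "B = mat_adjoint W * (A * W)"
  have AW: "A * W \<in> carrier_mat ?n ?n" using A Wc by simp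
  have B: "B \<in> carrier_mat ?n ?n" unfolding B_def using Wa AW by simp
  have hB: "mat_adjoint B = B"
    unfolding B_def adjoint_mult[OF Wa AW] adjoint_mult[OF A Wc] Suc.prems(2)
    using A Wc Wa by (simp add: assoc_mult_mat[of _ ?n ?n _ ?n _ ?n])
  \<comment> \<open>Column 0 of \<open>A * W\<close> is \<open>e\<close> times column 0 of
    \<open>W\<close>, and the columns of \<open>W\<close> are orthonormal.\<close>
  have B0: "B $$ (i, 0) = (if i = 0 then e else 0)" if i: "i < ?n" for i
  proof -
    have "B $$ (i, 0) = (\<Sum>k<?n. mat_adjoint W $$ (i, k) * (A * W) $$ (k, 0))"
      unfolding B_def using mult_index[OF Wa AW i, of 0] by simp
    also have "\<dots> = e * (\<Sum>k<?n. mat_adjoint W $$ (i, k) * W $$ (k, 0))"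
      unfolding sum_distrib_left by (intro sum.cong) (auto simp: col0 simp del: index_mult_mat)
    also have "\<dots> = e * (mat_adjoint W * W) $$ (i, 0)"
      using mult_index[OF Wa Wc i, of 0] by simp
    finally show ?thesis using i by (simp add: WW)
  qed
  have hB': "B $$ (i, j) = cnj (B $$ (j, i))" if "i < ?n" "j < ?n" for i j
    using adjoint_index[of i B j] that B hB by auto
  \<comment> \<open>A diagonal entry of a Hermitian matrix equals its own conjugate.\<close>
  have e: "e = complex_of_real (Re e)"
    using hB'[of 0 0] B0[of 0] by (simp add: complex_eq_iff)
  define C where "C = mat m m (\<lambda>(i, j). B $$ (Suc i, Suc j))"
  have C: "C \<in> carrier_mat m m" by (simp add: C_def)
  have "mat_adjoint C = C"
    by (intro eq_matI) (auto simp: C_def intro: hB'[symmetric])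
  from Suc.IH[OF C this] obtain V f where V: "unitary m V" and D: "mat_adjoint V * C * V = real_diag m f" by blast
  have Vc: "V \<in> carrier_mat m m" and VV: "mat_adjoint V * V = 1\<^sub>m m" using V by (auto simp: unitary_def)
  note Va = adjoint_carrier[OF Vc]
  \<comment> \<open>Block diagonal matrices with blocks of sizes 1 and \<open>m\<close>. Row 0 of
    \<open>B\<close> vanishes off the diagonal by Hermiticity, so \<open>B\<close> has this
    form.\<close>
  define F where "F X Y = four_block_mat (X :: complex mat) (0\<^sub>m 1 m) (0\<^sub>m m 1) Y" for X Y
  have FF: "F X Y * F X' Y' = F (X * X') (Y * Y')"
    if "X \<in> carrier_mat 1 1" "X' \<in> carrier_mat 1 1" "Y \<in> carrier_mat m m" "Y' \<in> carrier_mat m m" for X Y X' Y'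
    unfolding F_def using that by (subst mult_four_block_mat[of _ 1 1 _ m _ m _ _ 1 _ m]) auto
  have BF: "B = F (e \<cdot>\<^sub>m 1\<^sub>m 1) C"
  proof (rule eq_matI)
    fix i j assume "i < dim_row (F (e \<cdot>\<^sub>m 1\<^sub>m 1) C)" "j < dim_col (F (e \<cdot>\<^sub>m 1\<^sub>m 1) C)"
    then have ij: "i < ?n" "j < ?n" by (auto simp: F_def C_def)
    then show "B $$ (i, j) = F (e \<cdot>\<^sub>m 1\<^sub>m 1) C $$ (i, j)"
      using B0[OF ij(1)] B0[OF ij(2)] hB'[OF ij] C
      by (cases i; cases j) (auto simp: F_def C_def)
  qed (use B C in \<open>auto simp: F_def\<close>)
  have aF: "mat_adjoint (F (1\<^sub>m 1) V) = F (1\<^sub>m 1) (mat_adjoint V)"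
    using Vc by (intro eq_matI) (auto simp: F_def)
  have Fc: "F (1\<^sub>m 1) V \<in> carrier_mat ?n ?n" using Vc unfolding F_def by auto
  have "unitary ?n (F (1\<^sub>m 1) V)"
  proof (rule unitaryI[OF Fc])
    show "mat_adjoint (F (1\<^sub>m 1) V) * F (1\<^sub>m 1) V = 1\<^sub>m ?n"
      unfolding aF FF[OF one_carrier_mat one_carrier_mat Va Vc] VV by (simp add: F_def)
  qed
  note U = unitary_mult[OF W this]
  note Fa = adjoint_carrier[OF Fc]
  have "mat_adjoint (W * F (1\<^sub>m 1) V) * A * (W * F (1\<^sub>m 1) V)
      = mat_adjoint (F (1\<^sub>m 1) V) * B * F (1\<^sub>m 1) V"
    unfolding B_def adjoint_mult[OF Wc Fc] using A Wc Wa Fc Fa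
    by (simp add: assoc_mult_mat[of _ ?n ?n _ ?n _ ?n] mult_carrier_mat[of _ ?n ?n _ ?n])
  also have "\<dots> = F (e \<cdot>\<^sub>m 1\<^sub>m 1) (real_diag m f)"
    unfolding aF BF using Vc C D by (simp add: FF mult_carrier_mat[of _ m m _ m])
  \<comment> \<open>The new eigenvalue takes index 0 and shifts those of the smaller block by
    one.\<close>
  also have "\<dots> = real_diag ?n (\<lambda>i. if i = 0 then Re e else f (i - 1))"
    using e by (intro eq_matI) (auto simp: F_def real_diag_def)
  finally show ?case using U by blast
qed

section \<open>Positive semidefinite matrices and the trace norm\<close>

lemma quad_form:
  assumes "X \<in> carrier_mat n n" "v \<in> carrier_vec n"
  shows "(X *\<^sub>v v) \<bullet>c v = (\<Sum>i<n. \<Sum>j<n. X $$ (i, j) * v $ j * cnj (v $ i))"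
  using assms by (auto simp: scalar_prod_def atLeast0LessThan sum_distrib_right intro!: sum.cong)

lemma adjoint_scalar_prod:
  fixes U :: "complex mat"
  assumes U: "U \<in> carrier_mat n n" and v: "x \<in> carrier_vec n" "y \<in> carrier_vec n"
  shows "(mat_adjoint U *\<^sub>v x) \<bullet>c y = x \<bullet>c (U *\<^sub>v y)"
proof -
  have "(mat_adjoint U *\<^sub>v x) \<bullet>c y = (\<Sum>i<n. \<Sum>k<n. cnj (U $$ (k, i)) * x $ k * cnj (y $ i))"
    using assms by (auto simp: scalar_prod_def atLeast0LessThan sum_distrib_right intro!: sum.cong)
  also have "\<dots> = (\<Sum>k<n. \<Sum>i<n. cnj (U $$ (k, i)) * x $ k * cnj (y $ i))"
    by (rule sum.swap)
  also have "\<dots> = x \<bullet>c (U *\<^sub>v y)"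
    using assms by (auto simp: scalar_prod_def atLeast0LessThan sum_distrib_left mult_ac intro!: sum.cong)
  finally show ?thesis .
qed

lemma psd_carrier: "psd n X \<Longrightarrow> X \<in> carrier_mat n n"
  by (simp add: psd_def)

text \<open>The quadratic form of the new matrix at \<open>v\<close> is that of \<open>S\<close> at
  \<open>U v\<close>. With \<open>S\<close> the identity this covers Gram matrices, with
  \<open>U\<close> unitary a change of basis.\<close>

lemma psd_congruence:
  assumes S: "psd n S" and U: "U \<in> carrier_mat n n"
  shows "psd n (mat_adjoint U * S * U)"
proof -
  note Sc = psd_carrier[OF S] and Ua = adjoint_carrier[OF U]
  have "(mat_adjoint U * S * U *\<^sub>v v) \<bullet>c v = (S *\<^sub>v (U *\<^sub>v v)) \<bullet>c (U *\<^sub>v v)" if v: "v \<in> carrier_vec n" for v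
  proof -
    have "mat_adjoint U * S * U *\<^sub>v v = mat_adjoint U *\<^sub>v (S *\<^sub>v (U *\<^sub>v v))"
      using U Ua Sc v by (simp add: assoc_mult_mat_vec[of _ n n _ n] mult_carrier_mat[of _ n n _ n]
          mult_mat_vec_carrier[of _ n n])
    then show ?thesis using adjoint_scalar_prod[OF U] U Sc v by simp
  qed
  then show ?thesis
    using S U Sc Ua by (simp add: psd_def mult_carrier_mat[of _ n n _ n] del: assoc_mult_mat)
qed

lemma psd_one: "psd n (1\<^sub>m n)"
  by (auto simp: psd_def scalar_prod_def less_eq_complex_def intro!: add_nonneg_nonneg sum_nonneg)

lemma psd_gram: "X \<in> carrier_mat n n \<Longrightarrow> psd n (mat_adjoint X * X)"
  using psd_congruence[OF psd_one, of X n] right_mult_one_mat[OF adjoint_carrier, of X n n] by simp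

text \<open>The right-hand side is the quadratic form of \<open>X\<close> at
  \<open>e_k + c e_l\<close>. For \<open>k = l\<close> the two weights add up, so that
  \<open>c = 0\<close> returns the diagonal entry.\<close>

lemma psd_two_point:
  assumes X: "psd n X" and kl: "k < n" "l < n"
  shows "0 \<le> X $$ (k, k) + cnj c * c * X $$ (l, l) + c * X $$ (k, l) + cnj c * X $$ (l, k)"
proof -
  define w where "w b i = (if i = k then 1 else 0) + (if i = l then b else 0)" for b :: complex and i
  have w: "(\<Sum>i<n. g i * w b i) = g k + b * g l" for g b
  proof -
    have "(\<Sum>i<n. g i * w b i) = (\<Sum>i<n. (if i = k then g k else 0) + (if i = l then b * g l else 0))"
      by (intro sum.cong) (auto simp: w_def algebra_simps)
    then show ?thesis using kl by (simp add: sum.distrib)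
  qed
  have "0 \<le> (X *\<^sub>v vec n (w c)) \<bullet>c vec n (w c)" using X by (simp add: psd_def)
  also have "(X *\<^sub>v vec n (w c)) \<bullet>c vec n (w c) = (\<Sum>i<n. (\<Sum>j<n. X $$ (i, j) * w c j) * w (cnj c) i)"
    unfolding sum_distrib_right
    by (subst quad_form[OF psd_carrier[OF X]]) (auto simp: w_def intro!: sum.cong)
  also have "\<dots> = X $$ (k, k) + cnj c * c * X $$ (l, l) + c * X $$ (k, l) + cnj c * X $$ (l, k)"
    unfolding w by (simp add: algebra_simps)
  finally show ?thesis .
qed

lemma psd_diag_nonneg: "psd n X \<Longrightarrow> i < n \<Longrightarrow> 0 \<le> X $$ (i, i)"
  using psd_two_point[of n X i i 0] by simp

text \<open>Diagonal entries are real, so in the two-point form the contribution of the off-diagonal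
  pair must be real as well: \<open>c = 1\<close> makes the imaginary parts of the pair opposite,
  and \<open>c = \<i>\<close> makes the real parts equal.\<close>

lemma psd_hermitian:
  assumes X: "psd n X"
  shows "mat_adjoint X = X"
proof (rule eq_matI)
  fix i j assume "i < dim_row X" "j < dim_col X"
  then have ij: "i < n" "j < n" using psd_carrier[OF X] by auto
  show "mat_adjoint X $$ (i, j) = X $$ (i, j)"
    using psd_two_point[OF X ij, of 1] psd_two_point[OF X ij, of \<i>]
      psd_diag_nonneg[OF X ij(1)] psd_diag_nonneg[OF X ij(2)] ij psd_carrier[OF X]
    by (auto simp: less_eq_complex_def complex_eq_iff)
qed (use psd_carrier[OF X] in auto)

lemma psd_real_diag:
  assumes "\<And>i. i < n \<Longrightarrow> 0 \<le> f i"
  shows "psd n (real_diag n f)"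
proof -
  have "0 \<le> (real_diag n f *\<^sub>v v) \<bullet>c v" if v: "v \<in> carrier_vec n" for v
  proof -
    have "(real_diag n f *\<^sub>v v) \<bullet>c v = (\<Sum>i<n. complex_of_real (f i * (cmod (v $ i))\<^sup>2))"
      unfolding quad_form[OF real_diag_carrier v]
    proof (intro sum.cong refl)
      fix i assume i: "i \<in> {..<n}"
      have "(\<Sum>j<n. real_diag n f $$ (i, j) * v $ j * cnj (v $ i))
          = (\<Sum>j<n. if i = j then complex_of_real (f i) * v $ i * cnj (v $ i) else 0)"
        using i by (intro sum.cong) (auto simp: real_diag_def)
      then show "(\<Sum>j<n. real_diag n f $$ (i, j) * v $ j * cnj (v $ i)) = complex_of_real (f i * (cmod (v $ i))\<^sup>2)"
        using i by (simp add: complex_norm_square mult_ac del: of_real_power)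
    qed
    then show ?thesis using assms by (auto simp: less_eq_complex_def intro!: sum_nonneg simp del: of_real_mult)
  qed
  then show ?thesis by (simp add: psd_def)
qed

section \<open>Traces, diagonal matrices and unitary conjugation\<close>

lemma mat_trace_comm:
  assumes A: "A \<in> carrier_mat n n" and B: "B \<in> carrier_mat n n"
  shows "mat_trace (A * B) = mat_trace (B * A)"
proof -
  have "mat_trace (A * B) = (\<Sum>i<n. \<Sum>k<n. A $$ (i, k) * B $$ (k, i))"
    unfolding mat_trace_def using A B by (auto simp: mult_index[OF A B] simp del: index_mult_mat(1) intro!: sum.cong)
  also have "\<dots> = (\<Sum>k<n. \<Sum>i<n. B $$ (k, i) * A $$ (i, k))"
    by (subst sum.swap) (simp add: mult.commute)
  also have "\<dots> = mat_trace (B * A)"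
    unfolding mat_trace_def using A B by (auto simp: mult_index[OF B A] simp del: index_mult_mat(1) intro!: sum.cong)
  finally show ?thesis .
qed

lemma mat_trace_unitary:
  assumes U: "unitary n U" and A: "A \<in> carrier_mat n n"
  shows "mat_trace (mat_adjoint U * A * U) = mat_trace A"
proof -
  have Uc: "U \<in> carrier_mat n n" and Ua: "mat_adjoint U \<in> carrier_mat n n" and UU: "U * mat_adjoint U = 1\<^sub>m n"
    using U by (auto simp: unitary_def)
  have "mat_trace (mat_adjoint U * A * U) = mat_trace (U * (mat_adjoint U * A))"
    using Uc Ua A by (intro mat_trace_comm) auto
  also have "U * (mat_adjoint U * A) = A"
    using assoc_mult_mat[OF Uc Ua A] UU left_mult_one_mat[OF A] by simp
  finally show ?thesis .
qed

lemma mat_trace_real_diag: "mat_trace (real_diag n f) = (\<Sum>i<n. complex_of_real (f i))"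
  by (simp add: mat_trace_def real_diag_def)

lemma real_diag_mult: "real_diag n f * real_diag n g = real_diag n (\<lambda>i. f i * g i)"
proof (rule eq_matI)
  fix i j assume "i < dim_row (real_diag n (\<lambda>i. f i * g i))" "j < dim_col (real_diag n (\<lambda>i. f i * g i))"
  then have ij: "i < n" "j < n" by (auto simp: real_diag_def)
  have "(real_diag n f * real_diag n g) $$ (i, j)
      = (\<Sum>k<n. if i = k then complex_of_real (f i) * (if i = j then complex_of_real (g i) else 0) else 0)"
    unfolding mult_index[OF real_diag_carrier real_diag_carrier ij]
    using ij by (intro sum.cong) (auto simp: real_diag_def)
  then show "(real_diag n f * real_diag n g) $$ (i, j) = real_diag n (\<lambda>i. f i * g i) $$ (i, j)"
    using ij by (simp add: real_diag_def)
qed (auto simp: real_diag_def)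

lemma unitary_conj_cancel:
  assumes U: "unitary n U" and A: "A \<in> carrier_mat n n"
  shows "U * (mat_adjoint U * A * U) * mat_adjoint U = A"
proof -
  have Uc: "U \<in> carrier_mat n n" and Ua: "mat_adjoint U \<in> carrier_mat n n" and UU: "U * mat_adjoint U = 1\<^sub>m n"
    using U by (auto simp: unitary_def)
  have "U * (mat_adjoint U * A * U) * mat_adjoint U = (U * mat_adjoint U) * A * (U * mat_adjoint U)"
    using Uc Ua A by (simp add: assoc_mult_mat[of _ n n _ n _ n] mult_carrier_mat[of _ n n _ n])
  then show ?thesis unfolding UU using A by simp
qed

lemma unitary_conj_mult:
  assumes U: "unitary n U" and A: "A \<in> carrier_mat n n" and B: "B \<in> carrier_mat n n"
  shows "(mat_adjoint U * A * U) * (mat_adjoint U * B * U) = mat_adjoint U * (A * B) * U"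
proof -
  have Uc: "U \<in> carrier_mat n n" and Ua: "mat_adjoint U \<in> carrier_mat n n" and UU: "U * mat_adjoint U = 1\<^sub>m n"
    using U by (auto simp: unitary_def)
  have "(mat_adjoint U * A * U) * (mat_adjoint U * B * U) = mat_adjoint U * (A * ((U * mat_adjoint U) * (B * U)))"
    using Uc Ua A B by (simp add: assoc_mult_mat[of _ n n _ n _ n] mult_carrier_mat[of _ n n _ n])
  also have "\<dots> = mat_adjoint U * (A * B) * U"
    unfolding UU using Uc Ua A B
    by (simp add: assoc_mult_mat[of _ n n _ n _ n] mult_carrier_mat[of _ n n _ n] left_mult_one_mat[of _ n n])
  finally show ?thesis .
qed

lemma unitary_adjoint: "unitary n U \<Longrightarrow> unitary n (mat_adjoint U)"
  by (simp add: unitary_def)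

lemma unitary_conj_minus:
  assumes U: "U \<in> carrier_mat n n" and A: "A \<in> carrier_mat n n" and B: "B \<in> carrier_mat n n"
  shows "mat_adjoint U * (A - B) * U = mat_adjoint U * A * U - mat_adjoint U * B * U"
  using assms adjoint_carrier[OF U]
  by (simp add: mult_minus_distrib_mat[of _ n n _ n] minus_mult_distrib_mat[of _ n n _ _ n] mult_carrier_mat[of _ n n _ n])

section \<open>Existence of square roots\<close>

lemma psd_spectral:
  assumes A: "psd n A"
  obtains U f where "unitary n U" "\<And>i. i < n \<Longrightarrow> 0 \<le> f i" "mat_adjoint U * A * U = real_diag n f"
proof -
  obtain U f where U: "unitary n U" and f: "mat_adjoint U * A * U = real_diag n f"
    using hermitian_spectral[OF psd_carrier[OF A] psd_hermitian[OF A]] by blast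
  \<comment> \<open>Eigenvalues are diagonal entries of a matrix congruent to
    \<open>A\<close>.\<close>
  have "0 \<le> f i" if "i < n" for i
    using psd_diag_nonneg[OF psd_congruence[OF A], of U i] U that
    by (simp add: f unitary_def real_diag_def less_eq_complex_def)
  then show ?thesis using U f that by blast
qed

lemma psd_sqrt_exists:
  assumes A: "psd n A"
  shows "\<exists>S. psd n S \<and> S * S = A"
proof -
  obtain U f where U: "unitary n U" and f0: "\<And>i. i < n \<Longrightarrow> 0 \<le> f i" and f: "mat_adjoint U * A * U = real_diag n f"
    using psd_spectral[OF A] by blast
  \<comment> \<open>Conjugation by \<open>?V\<close> undoes conjugation by \<open>U\<close>, so the
    lemmas on \<open>mat_adjoint U * A * U\<close> also serve for the way back.\<close>
  let ?V = "mat_adjoint U" and ?D = "real_diag n (\<lambda>i. sqrt (f i))"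
  let ?S = "mat_adjoint ?V * ?D * ?V"
  have "psd n ?D" using f0 by (intro psd_real_diag) auto
  then have "psd n ?S" using U by (intro psd_congruence) (auto simp: unitary_def)
  moreover have "?D * ?D = real_diag n f"
    unfolding real_diag_mult using f0 by (intro eq_matI) (auto simp: real_diag_def simp flip: of_real_mult)
  then have "?S * ?S = A"
    using unitary_conj_mult[OF unitary_adjoint[OF U] real_diag_carrier real_diag_carrier]
      unitary_conj_cancel[OF U psd_carrier[OF A]] by (simp add: f)
  ultimately show ?thesis by blast
qed

section \<open>Perturbation bound and uniqueness for square roots\<close>

lemma cmod_unitary_le_one:
  assumes U: "unitary n U" and ij: "i < n" "j < n"
  shows "cmod (U $$ (i, j)) \<le> 1"
proof -
  have Uc: "U \<in> carrier_mat n n" and UU: "mat_adjoint U * U = 1\<^sub>m n" using U by (auto simp: unitary_def)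
  \<comment> \<open>Diagonal entries of \<open>mat_adjoint U * U = 1\<close> say that each column
    has norm one.\<close>
  have "complex_of_real (\<Sum>k<n. (cmod (U $$ (k, j)))\<^sup>2) = (mat_adjoint U * U) $$ (j, j)"
    unfolding mult_index[OF adjoint_carrier[OF Uc] Uc ij(2) ij(2)] of_real_sum
    using Uc ij by (intro sum.cong) (auto simp: complex_norm_square mult.commute simp del: of_real_power)
  then have "(\<Sum>k<n. (cmod (U $$ (k, j)))\<^sup>2) = 1" using ij by (simp add: UU del: of_real_sum)
  moreover have "(cmod (U $$ (i, j)))\<^sup>2 \<le> (\<Sum>k<n. (cmod (U $$ (k, j)))\<^sup>2)"
    using ij by (intro member_le_sum) auto
  ultimately show ?thesis by (simp add: power_le_one_iff abs_square_le_1)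
qed

text \<open>The entrywise 1-norm: crude, but it visibly tends to zero when all entries do, and it
  controls diagonal entries in every orthonormal basis.\<close>

definition entry_sum :: "complex mat \<Rightarrow> real" where
  "entry_sum X = (\<Sum>i<dim_row X. \<Sum>j<dim_col X. cmod (X $$ (i, j)))"

text \<open>Each entry of \<open>M\<close> enters with a coefficient that is a product of two
  entries of \<open>U\<close>, hence of modulus at most one.\<close>

lemma cmod_unitary_conj_le:
  assumes U: "unitary n U" and M: "M \<in> carrier_mat n n" and j: "j < n"
  shows "cmod ((mat_adjoint U * M * U) $$ (j, j)) \<le> entry_sum M"
proof -
  have Uc: "U \<in> carrier_mat n n" and Ua: "mat_adjoint U \<in> carrier_mat n n" using U by (auto simp: unitary_def)
  have MU: "M * U \<in> carrier_mat n n" using M Uc by simp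
  have "(mat_adjoint U * M * U) $$ (j, j) = (\<Sum>i<n. mat_adjoint U $$ (j, i) * (M * U) $$ (i, j))"
    unfolding assoc_mult_mat[OF Ua M Uc] by (rule mult_index[OF Ua MU j j])
  also have "\<dots> = (\<Sum>i<n. \<Sum>k<n. cnj (U $$ (i, j)) * M $$ (i, k) * U $$ (k, j))"
    using Uc j by (intro sum.cong refl) (simp add: mult_index[OF M Uc] sum_distrib_left mult.assoc del: index_mult_mat(1))
  also have "cmod \<dots> \<le> (\<Sum>i<n. \<Sum>k<n. cmod (M $$ (i, k)))"
  proof (intro order_trans[OF norm_sum] sum_mono order_trans[OF norm_sum])
    fix i k assume "i \<in> {..<n}" "k \<in> {..<n}"
    then show "cmod (cnj (U $$ (i, j)) * M $$ (i, k) * U $$ (k, j)) \<le> cmod (M $$ (i, k))"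
      using cmod_unitary_le_one[OF U, of i j] cmod_unitary_le_one[OF U, of k j] j
      by (simp add: norm_mult mult_left_le mult_left_le_one_le order_trans[OF mult_left_le])
  qed
  finally show ?thesis using M by (simp add: entry_sum_def)
qed

text \<open>In an eigenbasis of \<open>S - T\<close> the two matrices differ only on the diagonal,
  by the eigenvalues \<open>g j\<close>. The diagonal entries of the difference of squares then
  factor as \<open>g j\<close> times the sum of the two diagonal entries, and positivity makes that
  sum at least \<open>\<bar>g j\<bar>\<close>.\<close>

lemma psd_diff_eigenvalue_bound:
  assumes S: "psd n S" and T: "psd n T"
  obtains U g where "unitary n U" "mat_adjoint U * (S - T) * U = real_diag n g"
    "\<And>j. j < n \<Longrightarrow> (g j)\<^sup>2 \<le> entry_sum (S * S - T * T)"
proof -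
  note Sc = psd_carrier[OF S] and Tc = psd_carrier[OF T]
  have "mat_adjoint (S - T) = mat_adjoint S - mat_adjoint T" using Sc Tc by (intro eq_matI) auto
  then have "mat_adjoint (S - T) = S - T" using psd_hermitian[OF S] psd_hermitian[OF T] by simp
  moreover have "S - T \<in> carrier_mat n n" by (rule minus_carrier_mat[OF Tc])
  ultimately obtain U g where U: "unitary n U" and g: "mat_adjoint U * (S - T) * U = real_diag n g"
    using hermitian_spectral by blast
  have Uc: "U \<in> carrier_mat n n" using U by (simp add: unitary_def)
  define S' where "S' = mat_adjoint U * S * U"
  define T' where "T' = mat_adjoint U * T * U"
  have S': "psd n S'" and T': "psd n T'" using S T Uc by (auto simp: S'_def T'_def intro: psd_congruence)
  note S'c = psd_carrier[OF S'] and T'c = psd_carrier[OF T']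
  have D: "S' - T' = real_diag n g"
    using g unitary_conj_minus[OF Uc Sc Tc] by (simp add: S'_def T'_def)
  have D': "S' $$ (i, k) - T' $$ (i, k) = (if i = k then complex_of_real (g i) else 0)" if "i < n" "k < n" for i k
    using arg_cong[OF D, of "\<lambda>M. M $$ (i, k)"] that S'c T'c by (simp add: real_diag_def)
  have "(g j)\<^sup>2 \<le> entry_sum (S * S - T * T)" if j: "j < n" for j
  proof -
    have SS: "S * S \<in> carrier_mat n n" "T * T \<in> carrier_mat n n" "S * S - T * T \<in> carrier_mat n n" using Sc Tc by auto
    have "(mat_adjoint U * (S * S - T * T) * U) = S' * S' - T' * T'"
      unfolding S'_def T'_def using unitary_conj_mult[OF U Sc Sc] unitary_conj_mult[OF U Tc Tc]
        unitary_conj_minus[OF Uc SS(1,2)] by simp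
    then have "(mat_adjoint U * (S * S - T * T) * U) $$ (j, j) = (S' * S') $$ (j, j) - (T' * T') $$ (j, j)"
      using S'c T'c j by simp
    also have "\<dots> = (\<Sum>k<n. S' $$ (j, k) * S' $$ (k, j) - T' $$ (j, k) * T' $$ (k, j))"
      unfolding mult_index[OF S'c S'c j j] mult_index[OF T'c T'c j j] by (simp add: sum_subtractf)
    \<comment> \<open>Off the diagonal \<open>S'\<close> and \<open>T'\<close> agree, so all terms
      with \<open>k\<close> different from \<open>j\<close> cancel.\<close>
    also have "\<dots> = (\<Sum>k<n. if j = k then S' $$ (j, j) * S' $$ (j, j) - T' $$ (j, j) * T' $$ (j, j) else 0)"
    proof (intro sum.cong refl)
      fix k assume k: "k \<in> {..<n}"
      show "S' $$ (j, k) * S' $$ (k, j) - T' $$ (j, k) * T' $$ (k, j)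
          = (if j = k then S' $$ (j, j) * S' $$ (j, j) - T' $$ (j, j) * T' $$ (j, j) else 0)"
        using D'[of j k] D'[of k j] j k by (cases "j = k") auto
    qed
    also have "\<dots> = (S' $$ (j, j) - T' $$ (j, j)) * (S' $$ (j, j) + T' $$ (j, j))"
      using j by (simp add: algebra_simps)
    finally have eq: "(mat_adjoint U * (S * S - T * T) * U) $$ (j, j)
      = complex_of_real (g j) * (S' $$ (j, j) + T' $$ (j, j))" using D' j by simp
    have s: "0 \<le> S' $$ (j, j)" "0 \<le> T' $$ (j, j)" using psd_diag_nonneg S' T' j by auto
    \<comment> \<open>The difference of two nonnegative numbers is at most their sum in absolute
      value.\<close>
    have "\<bar>g j\<bar> \<le> cmod (S' $$ (j, j) + T' $$ (j, j))"
    proof -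
      have "g j = Re (S' $$ (j, j)) - Re (T' $$ (j, j))" using D'[OF j j] by (simp add: complex_eq_iff)
      then show ?thesis using s complex_Re_le_cmod[of "S' $$ (j, j) + T' $$ (j, j)"] by (auto simp: less_eq_complex_def)
    qed
    then have "(g j)\<^sup>2 \<le> cmod (complex_of_real (g j) * (S' $$ (j, j) + T' $$ (j, j)))"
      by (auto simp: norm_mult power2_eq_square abs_mult_self_eq[symmetric, of "g j"] simp del: abs_mult_self_eq intro!: mult_left_mono)
    also have "\<dots> \<le> entry_sum (S * S - T * T)"
      unfolding eq[symmetric] using U SS j by (intro cmod_unitary_conj_le) auto
    finally show ?thesis .
  qed
  then show ?thesis using U g that by blast
qed

text \<open>With equal squares the bound forces every eigenvalue of \<open>S - T\<close> to be zero,
  and a diagonalizable matrix with zero spectrum vanishes.\<close>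

lemma psd_sqrt_unique:
  assumes S: "psd n S" and T: "psd n T" and eq: "S * S = T * T"
  shows "S = T"
proof -
  note Sc = psd_carrier[OF S] and Tc = psd_carrier[OF T]
  obtain U g where U: "unitary n U" and g: "mat_adjoint U * (S - T) * U = real_diag n g"
    and b: "\<And>j. j < n \<Longrightarrow> (g j)\<^sup>2 \<le> entry_sum (S * S - T * T)"
    using psd_diff_eigenvalue_bound[OF S T] by blast
  have "entry_sum (S * S - T * T) = 0" using Tc unfolding eq by (simp add: entry_sum_def)
  then have "real_diag n g = 0\<^sub>m n n" using b by (intro eq_matI) (auto simp: real_diag_def)
  moreover have "S - T \<in> carrier_mat n n" by (rule minus_carrier_mat[OF Tc])
  ultimately have "S - T = U * 0\<^sub>m n n * mat_adjoint U"
    using unitary_conj_cancel[OF U, of "S - T"] g by simp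
  also have "\<dots> = 0\<^sub>m n n" using U by (simp add: unitary_def right_mult_zero_mat[of _ n n] left_mult_zero_mat[of _ n n])
  finally have ST: "S - T = 0\<^sub>m n n" .
  have "S $$ (i, j) - T $$ (i, j) = 0" if "i < n" "j < n" for i j
    using arg_cong[OF ST, of "\<lambda>M. M $$ (i, j)"] that Sc Tc by simp
  then show ?thesis using Sc Tc by (intro eq_matI) auto
qed

text \<open>The trace of \<open>S - T\<close> is the sum of its \<open>n\<close> eigenvalues, each
  bounded by the square root. Read with \<open>S\<close> and \<open>T\<close> as square roots, this
  makes the trace of the root continuous.\<close>

lemma trace_diff_le:
  assumes S: "psd n S" and T: "psd n T"
  shows "cmod (mat_trace S - mat_trace T) \<le> n * sqrt (entry_sum (S * S - T * T))"
proof -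
  note Sc = psd_carrier[OF S] and Tc = psd_carrier[OF T]
  obtain U g where U: "unitary n U" and g: "mat_adjoint U * (S - T) * U = real_diag n g"
    and b: "\<And>j. j < n \<Longrightarrow> (g j)\<^sup>2 \<le> entry_sum (S * S - T * T)"
    using psd_diff_eigenvalue_bound[OF S T] by blast
  have "mat_trace S - mat_trace T = mat_trace (S - T)"
    using Sc Tc by (simp add: mat_trace_def sum_subtractf)
  also have "\<dots> = (\<Sum>i<n. complex_of_real (g i))"
    using mat_trace_unitary[OF U minus_carrier_mat[OF Tc], of S] by (simp only: g mat_trace_real_diag)
  also have "cmod \<dots> \<le> (\<Sum>i<n. sqrt (entry_sum (S * S - T * T)))"
    using b by (intro order_trans[OF norm_sum] sum_mono) (auto intro: real_le_rsqrt)
  finally show ?thesis by simp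
qed

section \<open>The trace norm: evaluation, entry bound and continuity\<close>

lemma psd_sqrt_props:
  assumes A: "psd n A"
  shows "psd n (psd_sqrt A)" "psd_sqrt A * psd_sqrt A = A"
proof -
  have "\<exists>!S. psd (dim_row A) S \<and> S * S = A"
    using psd_sqrt_exists[OF A] psd_sqrt_unique psd_carrier[OF A] by auto
  from theI'[OF this] show "psd n (psd_sqrt A)" "psd_sqrt A * psd_sqrt A = A"
    using psd_carrier[OF A] by (auto simp: psd_sqrt_def)
qed

text \<open>By uniqueness of the root, exhibiting one positive semidefinite root of
  \<open>mat_adjoint X * X\<close> evaluates the trace norm.\<close>

lemma trace_norm_eqI:
  assumes X: "X \<in> carrier_mat n n" and S: "psd n S" "S * S = mat_adjoint X * X"
  shows "trace_norm X = Re (mat_trace S)"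
  using psd_sqrt_unique[OF psd_sqrt_props(1)[OF psd_gram[OF X]] S(1)] psd_sqrt_props(2)[OF psd_gram[OF X]] S(2)
  by (simp add: trace_norm_def)

text \<open>An entry is bounded by the Hilbert-Schmidt norm, and that by the trace norm: the 2-norm
  of the singular values \<open>f i\<close> is at most their 1-norm.\<close>

lemma cmod_entry_le_trace_norm:
  assumes X: "X \<in> carrier_mat n n" and ij: "i < n" "j < n"
  shows "cmod (X $$ (i, j)) \<le> trace_norm X"
proof -
  define S where "S = psd_sqrt (mat_adjoint X * X)"
  have S: "psd n S" and SS: "S * S = mat_adjoint X * X"
    using psd_sqrt_props[OF psd_gram[OF X]] by (auto simp: S_def)
  note Sc = psd_carrier[OF S]
  obtain U f where U: "unitary n U" and f0: "\<And>i. i < n \<Longrightarrow> 0 \<le> f i" and f: "mat_adjoint U * S * U = real_diag n f"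
    using psd_spectral[OF S] by blast
  have t: "trace_norm X = (\<Sum>i<n. f i)"
    using mat_trace_unitary[OF U Sc] unfolding f mat_trace_real_diag trace_norm_def S_def[symmetric]
    by (metis Re_complex_of_real of_real_sum)
  have "(cmod (X $$ (i, j)))\<^sup>2 \<le> (\<Sum>l<n. (cmod (X $$ (l, j)))\<^sup>2)"
    using ij by (intro member_le_sum) auto
  also have "\<dots> \<le> (\<Sum>k<n. \<Sum>l<n. (cmod (X $$ (l, k)))\<^sup>2)"
    using ij by (intro member_le_sum[of j "{..<n}" "\<lambda>k. \<Sum>l<n. (cmod (X $$ (l, k)))\<^sup>2"]) (auto intro: sum_nonneg)
  finally have le: "(cmod (X $$ (i, j)))\<^sup>2 \<le> (\<Sum>k<n. \<Sum>l<n. (cmod (X $$ (l, k)))\<^sup>2)" .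
  \<comment> \<open>The squared Hilbert-Schmidt norm is the trace of
    \<open>mat_adjoint X * X\<close>, evaluated next in the eigenbasis of its root.\<close>
  have "complex_of_real (\<Sum>k<n. \<Sum>l<n. (cmod (X $$ (l, k)))\<^sup>2) = mat_trace (S * S)"
    unfolding SS mat_trace_def of_real_sum using X
    by (auto simp: mult_index[OF adjoint_carrier[OF X] X] complex_norm_square mult.commute
        simp del: index_mult_mat(1) of_real_power intro!: sum.cong)
  also have "\<dots> = mat_trace (mat_adjoint U * (S * S) * U)"
    using mat_trace_unitary[OF U, of "S * S"] Sc by simp
  also have "mat_adjoint U * (S * S) * U = real_diag n (\<lambda>i. f i * f i)"
    using unitary_conj_mult[OF U Sc Sc] by (simp add: f real_diag_mult)
  also have "mat_trace \<dots> = complex_of_real (\<Sum>i<n. f i * f i)"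
    by (simp add: mat_trace_real_diag)
  finally have "(\<Sum>k<n. \<Sum>l<n. (cmod (X $$ (l, k)))\<^sup>2) = (\<Sum>i<n. f i * f i)"
    by (rule of_real_eq_iff[THEN iffD1])
  also have "\<dots> \<le> (\<Sum>i<n. f i * (\<Sum>k<n. f k))"
    using f0 by (intro sum_mono mult_left_mono member_le_sum) auto
  also have "\<dots> = (trace_norm X)\<^sup>2" by (simp add: t power2_eq_square sum_distrib_right)
  finally have "(cmod (X $$ (i, j)))\<^sup>2 \<le> (trace_norm X)\<^sup>2" using le by simp
  moreover have "0 \<le> trace_norm X" unfolding t by (intro sum_nonneg f0) auto
  ultimately show ?thesis by (rule power2_le_imp_le)
qed

text \<open>Entries of \<open>mat_adjoint X * X\<close> are polynomial in the entries of
  \<open>X\<close> and their conjugates, so they converge; \<open>trace_diff_le\<close> carries the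
  convergence over to the traces of the square roots.\<close>

lemma tendsto_trace_norm:
  assumes F: "\<And>m. F m \<in> carrier_mat n n" and X: "X \<in> carrier_mat n n"
    and lim: "\<And>i j. i < n \<Longrightarrow> j < n \<Longrightarrow> (\<lambda>m :: nat. F m $$ (i, j)) \<longlonglongrightarrow> X $$ (i, j)"
  shows "(\<lambda>m. trace_norm (F m)) \<longlonglongrightarrow> trace_norm X"
proof -
  define G where "G Y = mat_adjoint Y * Y" for Y :: "complex mat"
  have Gc: "G Y \<in> carrier_mat n n" if "Y \<in> carrier_mat n n" for Y unfolding G_def by (rule mult_carrier_mat[OF adjoint_carrier[OF that] that])
  have Gi: "G Y $$ (i, j) = (\<Sum>k<n. cnj (Y $$ (k, i)) * Y $$ (k, j))"
    if "Y \<in> carrier_mat n n" "i < n" "j < n" for Y i j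
    unfolding G_def mult_index[OF adjoint_carrier[OF that(1)] that] using that by (intro sum.cong) auto
  have es: "entry_sum (G (F m) - G X) = (\<Sum>i<n. \<Sum>j<n. cmod (G (F m) $$ (i, j) - G X $$ (i, j)))" for m
    using Gc[OF F] Gc[OF X] by (auto simp: entry_sum_def intro!: sum.cong)
  have G0: "(\<lambda>m. cmod (G (F m) $$ (i, j) - G X $$ (i, j))) \<longlonglongrightarrow> 0" if "i < n" "j < n" for i j
  proof (rule tendsto_norm_zero, rule LIM_zero)
    show "(\<lambda>m. G (F m) $$ (i, j)) \<longlonglongrightarrow> G X $$ (i, j)"
      unfolding Gi[OF F that] Gi[OF X that]
      using lim that by (intro tendsto_intros) auto
  qed
  have "(\<lambda>m. entry_sum (G (F m) - G X)) \<longlonglongrightarrow> (\<Sum>i<n. \<Sum>j<n. 0)"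
    unfolding es by (intro tendsto_sum G0) auto
  then have "(\<lambda>m. n * sqrt (entry_sum (G (F m) - G X))) \<longlonglongrightarrow> n * sqrt 0"
    by (intro tendsto_intros) simp
  then have "(\<lambda>m. n * sqrt (entry_sum (G (F m) - G X))) \<longlonglongrightarrow> 0" by simp
  then have "(\<lambda>m. trace_norm (F m) - trace_norm X) \<longlonglongrightarrow> 0"
  proof (rule tendsto_0_le[where K = 1], intro always_eventually allI)
    fix m
    note p = psd_sqrt_props[OF psd_gram[OF F[of m]]] and q = psd_sqrt_props[OF psd_gram[OF X]]
    have "\<bar>trace_norm (F m) - trace_norm X\<bar>
        \<le> cmod (mat_trace (psd_sqrt (G (F m))) - mat_trace (psd_sqrt (G X)))"
      unfolding trace_norm_def G_def minus_complex.sel(1)[symmetric] by (rule abs_Re_le_cmod)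
    also have "\<dots> \<le> n * sqrt (entry_sum (G (F m) - G X))"
      using trace_diff_le[OF p(1) q(1)] by (simp add: p(2) q(2) G_def)
    finally show "norm (trace_norm (F m) - trace_norm X) \<le> norm (n * sqrt (entry_sum (G (F m) - G X))) * 1"
      by simp
  qed
  then show ?thesis by (rule LIM_zero_cancel)
qed

lemma trace_norm_zero [simp]: "trace_norm (0\<^sub>m n n) = 0"
proof -
  have "0\<^sub>m n n = real_diag n (\<lambda>_. 0)" by (intro eq_matI) (auto simp: real_diag_def)
  then have "psd n (0\<^sub>m n n)" by (simp add: psd_real_diag)
  moreover have "0\<^sub>m n n * 0\<^sub>m n n = mat_adjoint (0\<^sub>m n n :: complex mat) * 0\<^sub>m n n"
    by (simp add: right_mult_zero_mat[of _ n n])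
  ultimately show ?thesis
    using trace_norm_eqI[OF zero_carrier_mat] by (simp add: mat_trace_def)
qed

section \<open>Kronecker products\<close>

lemma sum_mult_index: "(\<Sum>i<r * d. f i) = (\<Sum>k<r. \<Sum>a<d. f (k * d + a))" for f :: "nat \<Rightarrow> 'a::comm_monoid_add"
proof -
  have "sum f {k * d..<k * d + d} = (\<Sum>a<d. f (k * d + a))" for k
    by (rule sum.reindex_bij_witness[of _ "\<lambda>a. k * d + a" "\<lambda>i. i - k * d"]) auto
  then have "(\<Sum>k<r. \<Sum>a<d. f (k * d + a)) = (\<Sum>k<r. sum f {k * d..<k * d + d})" by simp
  also have "\<dots> = (\<Sum>i<r * d. f i)" by (rule sum.nat_group)
  finally show ?thesis ..
qed

lemma mult_index_less:
  fixes k r a d :: nat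
  assumes "k < r" "a < d"
  shows "k * d + a < r * d"
proof -
  have "k * d + a < Suc k * d" using assms(2) by simp
  also have "\<dots> \<le> r * d" using assms(1) by (intro mult_le_mono1) simp
  finally show ?thesis .
qed

lemma kron_carrier [simp]:
  "A \<in> carrier_mat r r \<Longrightarrow> B \<in> carrier_mat d d \<Longrightarrow> A \<otimes>\<^sub>K B \<in> carrier_mat (r * d) (r * d)"
  by (auto simp: kron_def)

lemma kron_index:
  assumes "A \<in> carrier_mat r r" "B \<in> carrier_mat d d" "i < r * d" "j < r * d"
  shows "(A \<otimes>\<^sub>K B) $$ (i, j) = A $$ (i div d, j div d) * B $$ (i mod d, j mod d)"
  using assms by (auto simp: kron_def)

lemma div_mod_less:
  fixes i r d :: nat
  assumes "i < r * d"
  shows "i div d < r" "i mod d < d"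
proof -
  show "i div d < r" using assms by (rule less_mult_imp_div_less)
  have "d > 0" using assms by (cases d) auto
  then show "i mod d < d" by simp
qed

lemma kron_mult:
  assumes A: "A \<in> carrier_mat r r" "A' \<in> carrier_mat r r" and B: "B \<in> carrier_mat d d" "B' \<in> carrier_mat d d"
  shows "(A \<otimes>\<^sub>K B) * (A' \<otimes>\<^sub>K B') = (A * A') \<otimes>\<^sub>K (B * B')"
proof -
  have AA: "A * A' \<in> carrier_mat r r" and BB: "B * B' \<in> carrier_mat d d" using A B by auto
  note c = kron_carrier[OF A(1) B(1)] kron_carrier[OF A(2) B(2)]
  show ?thesis
  proof (rule eq_matI)
    fix i j assume "i < dim_row ((A * A') \<otimes>\<^sub>K (B * B'))" "j < dim_col ((A * A') \<otimes>\<^sub>K (B * B'))"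
    then have ij: "i < r * d" "j < r * d" using kron_carrier[OF AA BB] by auto
    note i = div_mod_less[OF ij(1)] and j = div_mod_less[OF ij(2)]
    have "((A \<otimes>\<^sub>K B) * (A' \<otimes>\<^sub>K B')) $$ (i, j)
        = (\<Sum>k<r. \<Sum>a<d. (A $$ (i div d, k) * A' $$ (k, j div d)) * (B $$ (i mod d, a) * B' $$ (a, j mod d)))"
      unfolding mult_index[OF c ij] sum_mult_index
      using ij by (intro sum.cong refl) (simp add: kron_index[OF A(1) B(1)] kron_index[OF A(2) B(2)] mult_index_less)
    also have "\<dots> = ((A * A') \<otimes>\<^sub>K (B * B')) $$ (i, j)"
      unfolding kron_index[OF AA BB ij] mult_index[OF A i(1) j(1)] mult_index[OF B i(2) j(2)]
      by (simp add: sum_product)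
    finally show "((A \<otimes>\<^sub>K B) * (A' \<otimes>\<^sub>K B')) $$ (i, j) = ((A * A') \<otimes>\<^sub>K (B * B')) $$ (i, j)" .
  qed (use c kron_carrier[OF AA BB] in auto)
qed

lemma kron_adjoint:
  assumes A: "A \<in> carrier_mat r r" and B: "B \<in> carrier_mat d d"
  shows "mat_adjoint (A \<otimes>\<^sub>K B) = mat_adjoint A \<otimes>\<^sub>K mat_adjoint B"
proof (rule eq_matI)
  note Aa = adjoint_carrier[OF A] and Ba = adjoint_carrier[OF B]
  note c = kron_carrier[OF A B] kron_carrier[OF Aa Ba]
  fix i j assume "i < dim_row (mat_adjoint A \<otimes>\<^sub>K mat_adjoint B)" "j < dim_col (mat_adjoint A \<otimes>\<^sub>K mat_adjoint B)"
  then have ij: "i < r * d" "j < r * d" using c by auto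
  then show "mat_adjoint (A \<otimes>\<^sub>K B) $$ (i, j) = (mat_adjoint A \<otimes>\<^sub>K mat_adjoint B) $$ (i, j)"
    using c A B div_mod_less[OF ij(1)] div_mod_less[OF ij(2)]
    by (simp add: kron_index[OF A B] kron_index[OF Aa Ba] carrier_matD[OF c(1)])
qed (use A B in \<open>auto simp: kron_def\<close>)

lemma mat_trace_kron:
  assumes A: "A \<in> carrier_mat r r" and B: "B \<in> carrier_mat d d"
  shows "mat_trace (A \<otimes>\<^sub>K B) = mat_trace A * mat_trace B"
proof -
  have "mat_trace (A \<otimes>\<^sub>K B) = (\<Sum>k<r. \<Sum>a<d. A $$ (k, k) * B $$ (a, a))"
    using kron_carrier[OF A B] unfolding mat_trace_def
    by (auto simp: sum_mult_index kron_index[OF A B] mult_index_less intro!: sum.cong)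
  then show ?thesis using A B by (simp add: mat_trace_def sum_product)
qed

text \<open>With square roots \<open>S\<close> and \<open>T\<close> of the factors, the product is
  the Gram matrix of \<open>S \<otimes>\<^sub>K T\<close>.\<close>

lemma psd_kron:
  assumes A: "psd r A" and B: "psd d B"
  shows "psd (r * d) (A \<otimes>\<^sub>K B)"
proof -
  obtain S T where S: "psd r S" "S * S = A" and T: "psd d T" "T * T = B"
    using psd_sqrt_exists A B by meson
  note Sc = psd_carrier[OF S(1)] and Tc = psd_carrier[OF T(1)]
  have "A \<otimes>\<^sub>K B = mat_adjoint (S \<otimes>\<^sub>K T) * (S \<otimes>\<^sub>K T)"
    unfolding kron_adjoint[OF Sc Tc] psd_hermitian[OF S(1)] psd_hermitian[OF T(1)]
    by (simp add: kron_mult[OF Sc Sc Tc Tc] S T)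
  then show ?thesis using psd_gram[OF kron_carrier[OF Sc Tc]] by simp
qed

text \<open>Since \<omega> is positive semidefinite, the absolute value of
  \<open>X \<otimes>\<^sub>K \<omega>\<close> is that of \<open>X\<close> tensored with \<omega>,
  and its trace factors with \<open>mat_trace \<omega> = 1\<close>.\<close>

lemma trace_norm_kron_state:
  assumes X: "X \<in> carrier_mat r r" and \<omega>: "state d \<omega>"
  shows "trace_norm (X \<otimes>\<^sub>K \<omega>) = trace_norm X"
proof -
  define S where "S = psd_sqrt (mat_adjoint X * X)"
  have S: "psd r S" and SS: "S * S = mat_adjoint X * X"
    using psd_sqrt_props[OF psd_gram[OF X]] by (auto simp: S_def)
  have w: "psd d \<omega>" and t: "mat_trace \<omega> = 1" using \<omega> by (auto simp: state_def)
  note Sc = psd_carrier[OF S] and wc = psd_carrier[OF w] and Xa = adjoint_carrier[OF X]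
  have "(S \<otimes>\<^sub>K \<omega>) * (S \<otimes>\<^sub>K \<omega>) = mat_adjoint (X \<otimes>\<^sub>K \<omega>) * (X \<otimes>\<^sub>K \<omega>)"
    unfolding kron_adjoint[OF X wc] psd_hermitian[OF w] kron_mult[OF Sc Sc wc wc] kron_mult[OF Xa X wc wc] SS ..
  then show ?thesis
    using trace_norm_eqI[OF kron_carrier[OF X wc] psd_kron[OF S w]]
    by (simp only: mat_trace_kron[OF Sc wc] t trace_norm_def[of X] S_def[symmetric] mult_1_right)
qed

section \<open>States and superoperators\<close>

lemma state_carrier: "state n \<rho> \<Longrightarrow> \<rho> \<in> carrier_mat n n"
  by (simp add: state_def psd_def)

text \<open>For a fixed vector the quadratic form is linear in the entries, and nonnegative reals
  are closed under limits. It shows later that a limit of states is positive.\<close>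

lemma psd_limit:
  assumes F: "\<And>m :: nat. psd n (F m)" and X: "X \<in> carrier_mat n n"
    and lim: "\<And>i j. i < n \<Longrightarrow> j < n \<Longrightarrow> (\<lambda>m. F m $$ (i, j)) \<longlonglongrightarrow> X $$ (i, j)"
  shows "psd n X"
proof -
  have "0 \<le> (X *\<^sub>v v) \<bullet>c v" if v: "v \<in> carrier_vec n" for v
  proof -
    have lim: "(\<lambda>m. (F m *\<^sub>v v) \<bullet>c v) \<longlonglongrightarrow> (X *\<^sub>v v) \<bullet>c v"
      unfolding quad_form[OF X v] quad_form[OF psd_carrier[OF F] v]
      by (intro tendsto_intros lim) auto
    have "0 \<le> (F m *\<^sub>v v) \<bullet>c v" for m using F v by (simp add: psd_def)
    then have p: "0 \<le> Re ((F m *\<^sub>v v) \<bullet>c v)" "Im ((F m *\<^sub>v v) \<bullet>c v) = 0" for m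
      by (auto simp: less_eq_complex_def)
    have "0 \<le> Re ((X *\<^sub>v v) \<bullet>c v)"
      by (rule LIMSEQ_le_const[OF tendsto_Re[OF lim]]) (use p in auto)
    moreover have "Im ((X *\<^sub>v v) \<bullet>c v) = 0"
      using tendsto_Im[OF lim] p by (simp add: LIMSEQ_const_iff)
    ultimately show ?thesis by (simp add: less_eq_complex_def)
  qed
  then show ?thesis using X by (simp add: psd_def)
qed

section \<open>States span all matrices\<close>

definition rank_one :: "nat \<Rightarrow> (nat \<Rightarrow> complex) \<Rightarrow> complex mat" where
  "rank_one d w = mat d d (\<lambda>(i, j). w i * cnj (w j))"

definition mat_unit :: "nat \<Rightarrow> nat \<Rightarrow> nat \<Rightarrow> complex mat" where
  "mat_unit d k l = mat d d (\<lambda>(i, j). if i = k \<and> j = l then 1 else 0)"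

text \<open>Partial expansion of \<open>X\<close> in matrix units over a set of positions; inserting
  one position adds one term, which suits induction on finite sets.\<close>

definition restrict_entries :: "nat \<Rightarrow> complex mat \<Rightarrow> (nat \<times> nat) set \<Rightarrow> complex mat" where
  "restrict_entries d X S = mat d d (\<lambda>(i, j). if (i, j) \<in> S then X $$ (i, j) else 0)"

lemma mat_unit_carrier [simp]: "mat_unit d k l \<in> carrier_mat d d"
  by (simp add: mat_unit_def)

lemma rank_one_carrier [simp]: "rank_one d w \<in> carrier_mat d d"
  by (simp add: rank_one_def)

lemma restrict_entries_carrier [simp]: "restrict_entries d X S \<in> carrier_mat d d"
  by (simp add: restrict_entries_def)

lemma restrict_entries_insert:
  "p \<notin> S \<Longrightarrow> restrict_entries d X (insert p S) = restrict_entries d X S + X $$ p \<cdot>\<^sub>m mat_unit d (fst p) (snd p)"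
  by (rule eq_matI) (auto simp: restrict_entries_def mat_unit_def)

lemma restrict_entries_all: "X \<in> carrier_mat d d \<Longrightarrow> restrict_entries d X ({..<d} \<times> {..<d}) = X"
  by (rule eq_matI) (auto simp: restrict_entries_def)

lemma restrict_entries_empty: "restrict_entries d X {} = 0 \<cdot>\<^sub>m mat_unit d 0 0"
  by (rule eq_matI) (auto simp: restrict_entries_def mat_unit_def)

text \<open>\<open>rank_one d w\<close> is the unnormalized pure state |w><w|, whose quadratic form
  at \<open>v\<close> is the squared modulus of an inner product.\<close>

lemma psd_rank_one: "psd d (rank_one d w)"
proof -
  have "0 \<le> (rank_one d w *\<^sub>v v) \<bullet>c v" if v: "v \<in> carrier_vec d" for v
  proof -
    have "(rank_one d w *\<^sub>v v) \<bullet>c v = (\<Sum>i<d. \<Sum>j<d. (w i * cnj (v $ i)) * cnj (w j * cnj (v $ j)))"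
      unfolding quad_form[OF rank_one_carrier v] by (intro sum.cong refl) (auto simp: rank_one_def)
    also have "\<dots> = (\<Sum>i<d. w i * cnj (v $ i)) * cnj (\<Sum>i<d. w i * cnj (v $ i))"
      unfolding cnj_sum sum_product ..
    finally show ?thesis by (simp only: complex_mult_cnj) (simp add: less_eq_complex_def)
  qed
  then show ?thesis by (simp add: psd_def)
qed

lemma psd_smult:
  assumes X: "psd n X" and c: "0 \<le> c"
  shows "psd n (complex_of_real c \<cdot>\<^sub>m X)"
proof -
  note Xc = psd_carrier[OF X]
  note sc = smult_carrier_mat[OF Xc]
  have "0 \<le> (complex_of_real c \<cdot>\<^sub>m X *\<^sub>v v) \<bullet>c v" if v: "v \<in> carrier_vec n" for v
  proof -
    have "(complex_of_real c \<cdot>\<^sub>m X *\<^sub>v v) \<bullet>c v = complex_of_real c * ((X *\<^sub>v v) \<bullet>c v)"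
      unfolding quad_form[OF sc v] quad_form[OF Xc v] sum_distrib_left
      using Xc by (intro sum.cong refl) auto
    moreover have "0 \<le> (X *\<^sub>v v) \<bullet>c v" using X v by (simp add: psd_def)
    ultimately show ?thesis using c by (simp add: less_eq_complex_def)
  qed
  then show ?thesis using sc by (simp add: psd_def)
qed

lemma mat_trace_smult: "X \<in> carrier_mat n n \<Longrightarrow> mat_trace (c \<cdot>\<^sub>m X) = c * mat_trace X"
  by (simp add: mat_trace_def sum_distrib_left)

lemma mat_trace_add: "X \<in> carrier_mat n n \<Longrightarrow> Y \<in> carrier_mat n n \<Longrightarrow> mat_trace (X + Y) = mat_trace X + mat_trace Y"
  by (simp add: mat_trace_def sum.distrib)

text \<open>Normalized rank-one matrices are states; they yield the diagonal matrix units directly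
  and the others by polarization, and matrix units span. The rule thus reduces a property compatible
  with linear combinations to states.\<close>

lemma states_span_induct [consumes 1, case_names state add smult]:
  assumes X: "X \<in> carrier_mat d d"
    and st: "\<And>\<rho>. state d \<rho> \<Longrightarrow> P \<rho>"
    and add: "\<And>X Y. X \<in> carrier_mat d d \<Longrightarrow> Y \<in> carrier_mat d d \<Longrightarrow> P X \<Longrightarrow> P Y \<Longrightarrow> P (X + Y)"
    and smult: "\<And>c X. X \<in> carrier_mat d d \<Longrightarrow> P X \<Longrightarrow> P (c \<cdot>\<^sub>m X)"
    and d: "d > 0"
  shows "P X"
proof -
  \<comment> \<open>A nonzero entry makes the trace \<open>t\<close> positive, so the matrix is
    \<open>t\<close> times a state.\<close>
  have R: "P (rank_one d w)" if "k < d" "w k \<noteq> 0" for w k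
  proof -
    define t where "t = (\<Sum>i<d. (cmod (w i))\<^sup>2)"
    have "(cmod (w k))\<^sup>2 \<le> t" unfolding t_def using that by (intro member_le_sum) auto
    moreover have "0 < (cmod (w k))\<^sup>2" using that by simp
    ultimately have t: "t > 0" by linarith
    have tr: "mat_trace (rank_one d w) = complex_of_real t"
      by (simp add: mat_trace_def rank_one_def t_def complex_norm_square del: of_real_power)
    have "state d (complex_of_real (1 / t) \<cdot>\<^sub>m rank_one d w)"
      unfolding state_def mat_trace_smult[OF rank_one_carrier] tr
      using t by (auto intro!: psd_smult psd_rank_one simp del: of_real_divide simp flip: of_real_mult)
    then have "P (complex_of_real t \<cdot>\<^sub>m (complex_of_real (1 / t) \<cdot>\<^sub>m rank_one d w))"
      by (intro smult st) (auto dest: state_carrier)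
    also have "complex_of_real t \<cdot>\<^sub>m (complex_of_real (1 / t) \<cdot>\<^sub>m rank_one d w) = rank_one d w"
      using t by (intro eq_matI) (auto simp: rank_one_def)
    finally show ?thesis .
  qed
  have E1: "P (mat_unit d k k)" if k: "k < d" for k
  proof -
    have "mat_unit d k k = rank_one d (\<lambda>i. if i = k then 1 else 0)"
      by (rule eq_matI) (auto simp: mat_unit_def rank_one_def)
    then show ?thesis using R[OF k, of "\<lambda>i. if i = k then 1 else 0"] by simp
  qed
  have E: "P (mat_unit d k l)" if kl: "k < d" "l < d" for k l
  proof (cases "k = l")
    case True
    then show ?thesis using E1 kl by simp
  next
    case False
    let ?w = "\<lambda>c i. if i = k then 1 else if i = l then c else 0"
    \<comment> \<open>polarization\<close>
    have "mat_unit d k l = (1 / 2) \<cdot>\<^sub>m rank_one d (?w 1) + ((\<i> / 2) \<cdot>\<^sub>m rank_one d (?w \<i>)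
        + (- (1 + \<i>) / 2) \<cdot>\<^sub>m (mat_unit d k k + mat_unit d l l))"
      using False by (intro eq_matI) (auto simp: mat_unit_def rank_one_def field_simps)
    also have "P \<dots>"
      using kl by (intro add smult R[of k] E1 add_carrier_mat smult_carrier_mat mat_unit_carrier rank_one_carrier) auto
    finally show ?thesis .
  qed
  have "P (restrict_entries d X S)" if "finite S" "S \<subseteq> {..<d} \<times> {..<d}" for S
    using that
  proof (induction S rule: finite_induct)
    case empty
    \<comment> \<open>The zero matrix is reached as a multiple of the unit at (0, 0), an index that
      exists because \<open>d > 0\<close>.\<close>
    show ?case unfolding restrict_entries_empty using d by (intro smult E) auto
  next
    case (insert p S)
    then have "P (X $$ p \<cdot>\<^sub>m mat_unit d (fst p) (snd p))" by (intro smult E) auto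
    then show ?case unfolding restrict_entries_insert[OF insert.hyps(2)]
      using insert by (intro add) auto
  qed
  from this[of "{..<d} \<times> {..<d}"] show ?thesis using restrict_entries_all[OF X] by simp
qed

section \<open>Linear superoperators and channels\<close>

lemma
  assumes N: "linear_superop d N"
  shows superop_carrier: "X \<in> carrier_mat d d \<Longrightarrow> N X \<in> carrier_mat d d"
    and superop_add: "X \<in> carrier_mat d d \<Longrightarrow> Y \<in> carrier_mat d d \<Longrightarrow> N (X + Y) = N X + N Y"
    and superop_smult: "X \<in> carrier_mat d d \<Longrightarrow> N (c \<cdot>\<^sub>m X) = c \<cdot>\<^sub>m N X"
  using N by (auto simp: linear_superop_def)

lemma superop_diff:
  assumes N: "linear_superop d N" and X: "X \<in> carrier_mat d d" and Y: "Y \<in> carrier_mat d d"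
  shows "N (X - Y) = N X - N Y"
proof -
  have neg: "A - B = A + (-1) \<cdot>\<^sub>m B" if "A \<in> carrier_mat d d" "B \<in> carrier_mat d d" for A B :: "complex mat"
    using that by (intro eq_matI) auto
  show ?thesis
    using neg[OF X Y] neg[OF superop_carrier[OF N X] superop_carrier[OF N Y]] superop_add[OF N X, of "(-1) \<cdot>\<^sub>m Y"]
      superop_smult[OF N Y] Y by simp
qed

lemma superop_entry_expand:
  assumes N: "linear_superop d N" and X: "X \<in> carrier_mat d d" and ij: "i < d" "j < d"
  shows "N X $$ (i, j) = (\<Sum>p\<in>{..<d} \<times> {..<d}. X $$ p * N (mat_unit d (fst p) (snd p)) $$ (i, j))"
proof -
  have "N (restrict_entries d X S) $$ (i, j) = (\<Sum>p\<in>S. X $$ p * N (mat_unit d (fst p) (snd p)) $$ (i, j))"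
    if "finite S" "S \<subseteq> {..<d} \<times> {..<d}" for S
    using that
  proof (induction S rule: finite_induct)
    case empty
    show ?case unfolding restrict_entries_empty superop_smult[OF N mat_unit_carrier]
      using superop_carrier[OF N mat_unit_carrier, of 0 0] ij by simp
  next
    case (insert p S)
    have c: "N (restrict_entries d X S) \<in> carrier_mat d d" "N (mat_unit d (fst p) (snd p)) \<in> carrier_mat d d"
      using superop_carrier[OF N] by auto
    have "N (restrict_entries d X (insert p S))
        = N (restrict_entries d X S) + X $$ p \<cdot>\<^sub>m N (mat_unit d (fst p) (snd p))"
      unfolding restrict_entries_insert[OF insert.hyps(2)]
      by (simp add: superop_add[OF N] superop_smult[OF N])
    then show ?case using insert c ij by simp
  qed
  from this[of "{..<d} \<times> {..<d}"] show ?thesis using restrict_entries_all[OF X] by simp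
qed

lemma linear_superop_funpow: "linear_superop d N \<Longrightarrow> linear_superop d (N ^^ n)"
  by (induction n) (auto simp: linear_superop_def)

text \<open>For a trivial reference system the only block is \<open>X\<close> itself; statements
  about all \<open>R\<close> specialize to \<open>A\<close> alone through this.\<close>

lemma id_tensor_one:
  assumes N: "linear_superop d N" and X: "X \<in> carrier_mat d d"
  shows "id_tensor 1 d N X = N X"
proof (rule eq_matI)
  have b: "block d X 0 0 = X" using X by (intro eq_matI) (auto simp: block_def)
  fix i j assume "i < dim_row (N X)" "j < dim_col (N X)"
  then show "id_tensor 1 d N X $$ (i, j) = N X $$ (i, j)"
    using superop_carrier[OF N X] by (simp add: id_tensor_def b)
qed (use superop_carrier[OF N X] in \<open>auto simp: id_tensor_def\<close>)

text \<open>Positivity of the channel is complete positivity with a one-dimensional reference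
  system.\<close>

lemma channel_state:
  assumes N: "quantum_channel d N" and \<rho>: "state d \<rho>"
  shows "state d (N \<rho>)"
proof -
  have lin: "linear_superop d N" and cp: "completely_positive d N" and tp: "trace_preserving d N"
    using N by (auto simp: quantum_channel_def)
  have "psd (1 * d) (id_tensor 1 d N \<rho>)"
    using cp[unfolded completely_positive_def, rule_format, of 1 \<rho>] \<rho> by (simp add: state_def)
  then show ?thesis
    using id_tensor_one[OF lin state_carrier[OF \<rho>]] tp \<rho> state_carrier[OF \<rho>]
    by (simp add: state_def trace_preserving_def)
qed

lemma channel_funpow_state: "quantum_channel d N \<Longrightarrow> state d \<rho> \<Longrightarrow> state d ((N ^^ n) \<rho>)"
  by (induction n) (auto intro: channel_state)

lemma ex_state:
  assumes "d > 0"
  shows "\<exists>\<rho>. state d \<rho>"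
proof -
  have "mat_trace (rank_one d (\<lambda>i. if i = 0 then 1 else 0)) = (\<Sum>i<d. if i = 0 then 1 else 0)"
    unfolding mat_trace_def rank_one_def by (intro sum.cong) auto
  also have "\<dots> = 1" using assms by simp
  finally show ?thesis using psd_rank_one state_def by blast
qed

text \<open>Vectorizing matrices row by row turns \<open>N\<close> minus the identity map into a
  square matrix. Its transpose has a kernel by trace preservation, so its determinant vanishes and
  it has a kernel itself. The fixed matrix need not be positive.\<close>

lemma ex_fixed_matrix:
  assumes N: "linear_superop d N" "trace_preserving d N" and d: "d > 0"
  obtains X where "X \<in> carrier_mat d d" "X \<noteq> 0\<^sub>m d d" "N X = X"
proof -
  let ?u = "\<lambda>q. mat_unit d (q div d) (q mod d)"
  \<comment> \<open>Index \<open>p\<close> stands for position \<open>(p div d, p mod d)\<close>;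
    column \<open>q\<close> holds the image of the \<open>q\<close>-th matrix unit under
    \<open>N\<close> minus the identity map.\<close>
  define M where "M = mat (d * d) (d * d) (\<lambda>(p, q). N (?u q) $$ (p div d, p mod d) - (if p = q then 1 else 0))"
  have M: "M \<in> carrier_mat (d * d) (d * d)" by (simp add: M_def)
  \<comment> \<open>the identity matrix, written as a vector: by trace preservation it is in the left kernel of \<open>M\<close>\<close>
  define w :: "complex vec" where "w = vec (d * d) (\<lambda>p. if p div d = p mod d then 1 else 0)"
  \<comment> \<open>Pairing a vectorized matrix with \<open>w\<close> gives its trace.\<close>
  have tr: "(\<Sum>p<d * d. Y $$ (p div d, p mod d) * (if p div d = p mod d then 1 else 0)) = mat_trace Y"
    if "Y \<in> carrier_mat d d" for Y
    unfolding sum_mult_index using that by (simp add: mat_trace_def if_distrib[of "(*) _"] sum.delta cong: if_cong)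
  have "transpose_mat M *\<^sub>v w = 0\<^sub>v (d * d)"
  proof (rule eq_vecI)
    fix q assume "q < dim_vec (0\<^sub>v (d * d) :: complex vec)"
    then have q: "q < d * d" by simp
    have "(transpose_mat M *\<^sub>v w) $ q = (\<Sum>p<d * d. M $$ (p, q) * w $ p)"
      using q M by (auto simp: scalar_prod_def atLeast0LessThan w_def intro!: sum.cong)
    also have "\<dots> = (\<Sum>p<d * d. N (?u q) $$ (p div d, p mod d) * (if p div d = p mod d then 1 else 0)
        - (if p = q then w $ q else 0))"
      using q by (intro sum.cong) (auto simp: M_def w_def)
    also have "\<dots> = mat_trace (N (?u q)) - w $ q"
      unfolding sum_subtractf tr[OF superop_carrier[OF N(1) mat_unit_carrier]] using q by simp
    also have "mat_trace (N (?u q)) = mat_trace (?u q)" using N(2) by (simp add: trace_preserving_def)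
    also have "\<dots> = (\<Sum>i<d. if i = q div d then (if q div d = q mod d then 1 else 0) else 0)"
      by (auto simp: mat_trace_def mat_unit_def intro!: sum.cong)
    also have "\<dots> = w $ q" using q div_mod_less[OF q] by (simp add: w_def)
    finally show "(transpose_mat M *\<^sub>v w) $ q = 0\<^sub>v (d * d) $ q" using q by simp
  qed (use M in simp)
  moreover have "w $ 0 \<noteq> 0\<^sub>v (d * d) $ 0" using d by (simp add: w_def)
  then have "w \<noteq> 0\<^sub>v (d * d)" by metis
  moreover have "w \<in> carrier_vec (d * d)" by (simp add: w_def)
  ultimately have "det (transpose_mat M) = 0"
    using det_0_iff_vec_prod_zero[of "transpose_mat M" "d * d"] M by auto
  then have "det M = 0" by (simp add: det_transpose[OF M])
  then obtain v where v: "v \<in> carrier_vec (d * d)" "v \<noteq> 0\<^sub>v (d * d)" and Mv: "M *\<^sub>v v = 0\<^sub>v (d * d)"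
    using det_0_iff_vec_prod_zero[OF M] by blast
  \<comment> \<open>The kernel vector, reshaped into a matrix.\<close>
  define X where "X = mat d d (\<lambda>(i, j). v $ (i * d + j))"
  have X: "X \<in> carrier_mat d d" by (simp add: X_def)
  have "X \<noteq> 0\<^sub>m d d"
  proof
    assume X0: "X = 0\<^sub>m d d"
    have "v = 0\<^sub>v (d * d)"
    proof (rule eq_vecI)
      fix q assume "q < dim_vec (0\<^sub>v (d * d) :: complex vec)"
      then have q: "q < d * d" by simp
      have "X $$ (q div d, q mod d) = v $ q" using div_mod_less[OF q] by (simp add: X_def)
      then show "v $ q = 0\<^sub>v (d * d) $ q" using div_mod_less[OF q] q by (simp add: X0)
    qed (use v in simp)
    then show False using v by simp
  qed
  moreover have "N X = X"
  proof (rule eq_matI)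
    fix i j assume "i < dim_row X" "j < dim_col X"
    then have ij: "i < d" "j < d" by (auto simp: X_def)
    let ?p = "i * d + j"
    have p: "?p < d * d" using mult_index_less ij by blast
    have "0 = (M *\<^sub>v v) $ ?p" using Mv p by simp
    also have "\<dots> = (\<Sum>q<d * d. M $$ (?p, q) * v $ q)"
      using p M v by (auto simp: scalar_prod_def atLeast0LessThan intro!: sum.cong)
    also have "\<dots> = (\<Sum>q<d * d. v $ q * N (?u q) $$ (i, j) - (if q = ?p then v $ ?p else 0))"
      using p ij by (intro sum.cong) (auto simp: M_def algebra_simps)
    also have "\<dots> = (\<Sum>q<d * d. v $ q * N (?u q) $$ (i, j)) - v $ ?p"
      unfolding sum_subtractf using p by simp
    also have "(\<Sum>q<d * d. v $ q * N (?u q) $$ (i, j)) = (\<Sum>k<d. \<Sum>l<d. X $$ (k, l) * N (mat_unit d k l) $$ (i, j))"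
      unfolding sum_mult_index by (intro sum.cong refl) (auto simp: X_def)
    also have "\<dots> = N X $$ (i, j)"
      unfolding superop_entry_expand[OF N(1) X ij] by (simp add: sum.cartesian_product split_def)
    finally show "N X $$ (i, j) = X $$ (i, j)" using ij by (simp add: X_def)
  qed (use superop_carrier[OF N(1) X] X in auto)
  ultimately show ?thesis using X that by blast
qed

section \<open>Asymptotics of the iterates\<close>

text \<open>Both terms are linear in \<open>X\<close>, so the claim passes from states, where the
  trace is one, to their span. The sequence \<open>b\<close> is left free: it is the constant entry
  of \<omega> under mixing, and the orbit of a reference state under replacing, where no limit is
  known yet.\<close>

lemma funpow_asymptotics:
  assumes N: "linear_superop d N" and d: "d > 0"
    and B: "\<And>\<rho>. state d \<rho> \<Longrightarrow> (\<lambda>n. (N ^^ n) \<rho> $$ (i, j) - b n) \<longlonglongrightarrow> 0"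
    and ij: "i < d" "j < d" and X: "X \<in> carrier_mat d d"
  shows "(\<lambda>n. (N ^^ n) X $$ (i, j) - mat_trace X * b n) \<longlonglongrightarrow> 0"
  using X
proof (induction X rule: states_span_induct)
  case (state \<rho>)
  then show ?case using B[OF state] by (simp add: state_def)
next
  case (add X Y)
  note l = linear_superop_funpow[OF N]
  have "(N ^^ n) (X + Y) $$ (i, j) - mat_trace (X + Y) * b n
      = ((N ^^ n) X $$ (i, j) - mat_trace X * b n) + ((N ^^ n) Y $$ (i, j) - mat_trace Y * b n)" for n
    using superop_carrier[OF l add(1), of n] superop_carrier[OF l add(2), of n] ij
    by (simp add: superop_add[OF l add(1,2)] mat_trace_add[OF add(1,2)] algebra_simps)
  then show ?case using tendsto_add[OF add(3,4)] by simp
next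
  case (smult c X)
  note l = linear_superop_funpow[OF N]
  have "(N ^^ n) (c \<cdot>\<^sub>m X) $$ (i, j) - mat_trace (c \<cdot>\<^sub>m X) * b n
      = c * ((N ^^ n) X $$ (i, j) - mat_trace X * b n)" for n
    using superop_carrier[OF l smult(1), of n] ij
    by (simp add: superop_smult[OF l smult(1)] mat_trace_smult[OF smult(1)] algebra_simps)
  then show ?case using tendsto_mult_right_zero[OF smult(2), of c] by simp
qed (rule d)

lemma trace_norm_tendsto_0_entry:
  assumes F: "\<And>n. F n \<in> carrier_mat d d" and lim: "(\<lambda>n :: nat. trace_norm (F n)) \<longlonglongrightarrow> 0" and ij: "i < d" "j < d"
  shows "(\<lambda>n. F n $$ (i, j)) \<longlonglongrightarrow> 0"
  by (rule tendsto_0_le[OF lim, where K = 1], intro always_eventually allI)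
    (use cmod_entry_le_trace_norm[OF F ij] in \<open>auto intro: order_trans[OF _ abs_ge_self]\<close>)

lemma mixing_limit:
  assumes N: "quantum_channel d N" and d: "d > 0" and \<omega>: "state d \<omega>"
    and mix: "\<And>\<rho>. state d \<rho> \<Longrightarrow> (\<lambda>n. trace_norm ((N ^^ n) \<rho> - \<omega>)) \<longlonglongrightarrow> 0"
    and X: "X \<in> carrier_mat d d" and ij: "i < d" "j < d"
  shows "(\<lambda>n. (N ^^ n) X $$ (i, j)) \<longlonglongrightarrow> mat_trace X * \<omega> $$ (i, j)"
proof -
  have lin: "linear_superop d N" using N by (simp add: quantum_channel_def)
  note \<omega>c = state_carrier[OF \<omega>]
  have "(\<lambda>n. (N ^^ n) X $$ (i, j) - mat_trace X * \<omega> $$ (i, j)) \<longlonglongrightarrow> 0"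
  proof (rule funpow_asymptotics[OF lin d _ ij X])
    fix \<rho> assume \<rho>: "state d \<rho>"
    have "(\<lambda>n. ((N ^^ n) \<rho> - \<omega>) $$ (i, j)) \<longlonglongrightarrow> 0"
      by (rule trace_norm_tendsto_0_entry[OF minus_carrier_mat[OF \<omega>c] mix[OF \<rho>] ij])
    then show "(\<lambda>n. (N ^^ n) \<rho> $$ (i, j) - \<omega> $$ (i, j)) \<longlonglongrightarrow> 0" using \<omega>c ij by simp
  qed
  then show ?thesis by (rule LIM_zero_cancel)
qed

text \<open>Each of the finitely many blocks converges to its trace times \<omega>, so the whole
  matrix converges to \<open>ptrace_A r d X \<otimes>\<^sub>K \<omega>\<close>. Arbitrary
  \<open>X\<close> is allowed so that both replacing and decoupling are instances.\<close>

lemma mixing_id_tensor_limit: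
  assumes N: "quantum_channel d N" and d: "d > 0" and \<omega>: "state d \<omega>"
    and mix: "\<And>\<rho>. state d \<rho> \<Longrightarrow> (\<lambda>n. trace_norm ((N ^^ n) \<rho> - \<omega>)) \<longlonglongrightarrow> 0"
    and X: "X \<in> carrier_mat (r * d) (r * d)"
  shows "(\<lambda>n. trace_norm (id_tensor r d (N ^^ n) X)) \<longlonglongrightarrow> trace_norm (ptrace_A r d X)"
proof -
  have P: "ptrace_A r d X \<in> carrier_mat r r" by (simp add: ptrace_A_def)
  note \<omega>c = state_carrier[OF \<omega>]
  have "(\<lambda>n. trace_norm (id_tensor r d (N ^^ n) X)) \<longlonglongrightarrow> trace_norm (ptrace_A r d X \<otimes>\<^sub>K \<omega>)"
  proof (rule tendsto_trace_norm)
    fix i j assume ij: "i < r * d" "j < r * d"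
    \<comment> \<open>The traces of the blocks are exactly the entries of the partial trace.\<close>
    have "mat_trace (block d X (i div d) (j div d)) = ptrace_A r d X $$ (i div d, j div d)"
      using div_mod_less[OF ij(1)] div_mod_less[OF ij(2)] by (simp add: mat_trace_def block_def ptrace_A_def)
    then show "(\<lambda>n. id_tensor r d (N ^^ n) X $$ (i, j)) \<longlonglongrightarrow> (ptrace_A r d X \<otimes>\<^sub>K \<omega>) $$ (i, j)"
      using mixing_limit[OF N d \<omega> mix, of "block d X (i div d) (j div d)" "i mod d" "j mod d"] ij d
      by (simp add: id_tensor_def kron_index[OF P \<omega>c] block_def)
  qed (use P \<omega>c in \<open>auto simp: id_tensor_def\<close>)
  then show ?thesis by (simp add: trace_norm_kron_state[OF P \<omega>])
qed

section \<open>Implications between mixing, replacing and decoupling\<close>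

lemma ptrace_A_diff:
  assumes X: "X \<in> carrier_mat (r * d) (r * d)" and Y: "Y \<in> carrier_mat (r * d) (r * d)"
  shows "ptrace_A r d (X - Y) = ptrace_A r d X - ptrace_A r d Y"
  using assms by (intro eq_matI) (auto simp: ptrace_A_def mult_index_less sum_subtractf)

lemma ptrace_A_kron:
  assumes A: "A \<in> carrier_mat r r" and B: "B \<in> carrier_mat d d"
  shows "ptrace_A r d (A \<otimes>\<^sub>K B) = mat_trace B \<cdot>\<^sub>m A"
proof (rule eq_matI)
  fix k l assume "k < dim_row (mat_trace B \<cdot>\<^sub>m A)" "l < dim_col (mat_trace B \<cdot>\<^sub>m A)"
  then have kl: "k < r" "l < r" using A by auto
  have "ptrace_A r d (A \<otimes>\<^sub>K B) $$ (k, l) = (\<Sum>a<d. A $$ (k, l) * B $$ (a, a))"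
    using kl unfolding ptrace_A_def by (simp add: kron_index[OF A B] mult_index_less)
  then show "ptrace_A r d (A \<otimes>\<^sub>K B) $$ (k, l) = (mat_trace B \<cdot>\<^sub>m A) $$ (k, l)"
    using kl A B by (simp add: mat_trace_def mult.commute flip: sum_distrib_left)
qed (use A in \<open>auto simp: ptrace_A_def\<close>)

lemma ptrace_A_one: "X \<in> carrier_mat d d \<Longrightarrow> ptrace_A 1 d X = mat_trace X \<cdot>\<^sub>m 1\<^sub>m 1"
  by (intro eq_matI) (auto simp: ptrace_A_def mat_trace_def)

lemma mixing_imp_replacing:
  assumes N: "quantum_channel d N" and d: "d > 0" and "mixing d N"
  shows "replacing d N"
proof -
  obtain \<omega> where \<omega>: "state d \<omega>" and mix: "\<And>\<rho>. state d \<rho> \<Longrightarrow> (\<lambda>n. trace_norm ((N ^^ n) \<rho> - \<omega>)) \<longlonglongrightarrow> 0"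
    using assms(3) by (auto simp: mixing_def unique_fixed_state_def)
  have "(\<lambda>n. trace_norm (id_tensor r d (N ^^ n) (\<rho> - \<sigma>)))
      \<longlonglongrightarrow> trace_norm (ptrace_A r d \<rho> - ptrace_A r d \<sigma>)"
    if \<rho>: "state (r * d) \<rho>" and \<sigma>: "state (r * d) \<sigma>" for r \<rho> \<sigma>
    using mixing_id_tensor_limit[OF N d \<omega> mix minus_carrier_mat[OF state_carrier[OF \<sigma>]], of \<rho>]
    unfolding ptrace_A_diff[OF state_carrier[OF \<rho>] state_carrier[OF \<sigma>]] .
  then show ?thesis unfolding replacing_def by blast
qed

text \<open>The partial trace of
  \<open>\<rho> - ptrace_A r d \<rho> \<otimes>\<^sub>K \<omega>\<close> vanishes because \<omega>
  has trace one, so the general limit is zero.\<close>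

lemma mixing_imp_decoupling:
  assumes N: "quantum_channel d N" and d: "d > 0" and "mixing d N"
  shows "decoupling d N"
proof -
  obtain \<omega> where u: "unique_fixed_state d N \<omega>"
    and mix: "\<And>\<rho>. state d \<rho> \<Longrightarrow> (\<lambda>n. trace_norm ((N ^^ n) \<rho> - \<omega>)) \<longlonglongrightarrow> 0"
    using assms(3) by (auto simp: mixing_def)
  have \<omega>: "state d \<omega>" using u by (simp add: unique_fixed_state_def)
  note \<omega>c = state_carrier[OF \<omega>]
  have "(\<lambda>n. trace_norm (id_tensor r d (N ^^ n) (\<rho> - ptrace_A r d \<rho> \<otimes>\<^sub>K \<omega>))) \<longlonglongrightarrow> 0"
    if \<rho>: "state (r * d) \<rho>" for r \<rho>
  proof -
    have P: "ptrace_A r d \<rho> \<in> carrier_mat r r" by (simp add: ptrace_A_def)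
    note K = kron_carrier[OF P \<omega>c]
    have "ptrace_A r d (\<rho> - ptrace_A r d \<rho> \<otimes>\<^sub>K \<omega>) = ptrace_A r d \<rho> - 1 \<cdot>\<^sub>m ptrace_A r d \<rho>"
      using \<omega> by (simp add: ptrace_A_diff[OF state_carrier[OF \<rho>] K] ptrace_A_kron[OF P \<omega>c] state_def)
    also have "\<dots> = 0\<^sub>m r r" using P by (intro eq_matI) auto
    finally show ?thesis using mixing_id_tensor_limit[OF N d \<omega> mix minus_carrier_mat[OF K], of \<rho>] by simp
  qed
  then show ?thesis using u by (auto simp: decoupling_def)
qed

text \<open>For \<open>r = 1\<close> the marginal on \<open>R\<close> is the number one and the
  product state is \<omega>, which the iterates leave fixed.\<close>

lemma decoupling_imp_mixing:
  assumes N: "quantum_channel d N" and "decoupling d N"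
  shows "mixing d N"
proof -
  have lin: "linear_superop d N" using N by (simp add: quantum_channel_def)
  note l = linear_superop_funpow[OF lin]
  obtain \<omega> where u: "unique_fixed_state d N \<omega>"
    and dec: "\<And>r \<rho>. r > 0 \<Longrightarrow> state (r * d) \<rho> \<Longrightarrow>
      (\<lambda>n. trace_norm (id_tensor r d (N ^^ n) (\<rho> - ptrace_A r d \<rho> \<otimes>\<^sub>K \<omega>))) \<longlonglongrightarrow> 0"
    using assms(2) by (auto simp: decoupling_def)
  have \<omega>: "state d \<omega>" and N\<omega>: "N \<omega> = \<omega>" using u by (auto simp: unique_fixed_state_def)
  note \<omega>c = state_carrier[OF \<omega>]
  have Nn\<omega>: "(N ^^ n) \<omega> = \<omega>" for n by (induction n) (auto simp: N\<omega>)
  have "(\<lambda>n. trace_norm ((N ^^ n) \<rho> - \<omega>)) \<longlonglongrightarrow> 0" if \<rho>: "state d \<rho>" for \<rho>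
  proof -
    note \<rho>c = state_carrier[OF \<rho>]
    have "ptrace_A 1 d \<rho> \<otimes>\<^sub>K \<omega> = \<omega>"
      unfolding ptrace_A_one[OF \<rho>c] using \<rho> \<omega>c by (intro eq_matI) (auto simp: state_def kron_def)
    moreover have "id_tensor 1 d (N ^^ n) (\<rho> - \<omega>) = (N ^^ n) \<rho> - \<omega>" for n
      by (simp add: id_tensor_one[OF l minus_carrier_mat[OF \<omega>c], unfolded One_nat_def] superop_diff[OF l \<rho>c \<omega>c] Nn\<omega>)
    ultimately show ?thesis using dec[of 1 \<rho>] \<rho> by simp
  qed
  then show ?thesis using u by (auto simp: mixing_def)
qed

lemma replacing_imp_mixing:
  assumes N: "quantum_channel d N" and d: "d > 0" and rep: "replacing d N"
  shows "mixing d N"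
proof -
  have lin: "linear_superop d N" and tp: "trace_preserving d N" using N by (auto simp: quantum_channel_def)
  note l = linear_superop_funpow[OF lin]
  obtain \<sigma> where \<sigma>: "state d \<sigma>" using ex_state[OF d] by blast
  note \<sigma>c = state_carrier[OF \<sigma>]
  \<comment> \<open>Replacing with \<open>r = 1\<close>: both marginals on \<open>R\<close> equal
    one, so all orbits of states approach each other, without any limit being known.\<close>
  have lim: "(\<lambda>n. (N ^^ n) \<rho> $$ (i, j) - (N ^^ n) \<sigma> $$ (i, j)) \<longlonglongrightarrow> 0"
    if \<rho>: "state d \<rho>" and ij: "i < d" "j < d" for \<rho> i j
  proof -
    note \<rho>c = state_carrier[OF \<rho>]
    have "state (1 * d) \<rho>" "state (1 * d) \<sigma>" using \<rho> \<sigma> by auto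
    then have "(\<lambda>n. trace_norm (id_tensor 1 d (N ^^ n) (\<rho> - \<sigma>)))
        \<longlonglongrightarrow> trace_norm (ptrace_A 1 d \<rho> - ptrace_A 1 d \<sigma>)"
      using rep[unfolded replacing_def, rule_format, of 1 \<rho> \<sigma>] by simp
    also have "ptrace_A 1 d \<rho> - ptrace_A 1 d \<sigma> = 0\<^sub>m 1 1"
      unfolding ptrace_A_one[OF \<rho>c] ptrace_A_one[OF \<sigma>c] using \<rho> \<sigma> by (intro eq_matI) (auto simp: state_def)
    finally have t: "(\<lambda>n. trace_norm ((N ^^ n) \<rho> - (N ^^ n) \<sigma>)) \<longlonglongrightarrow> 0"
      unfolding id_tensor_one[OF l minus_carrier_mat[OF \<sigma>c]] superop_diff[OF l \<rho>c \<sigma>c] by simp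
    note c = superop_carrier[OF l \<sigma>c]
    have "(\<lambda>n. ((N ^^ n) \<rho> - (N ^^ n) \<sigma>) $$ (i, j)) \<longlonglongrightarrow> 0"
      by (rule trace_norm_tendsto_0_entry[OF minus_carrier_mat[OF c] t ij])
    moreover have "((N ^^ n) \<rho> - (N ^^ n) \<sigma>) $$ (i, j) = (N ^^ n) \<rho> $$ (i, j) - (N ^^ n) \<sigma> $$ (i, j)" for n
      using c[of n] ij by simp
    ultimately show ?thesis by simp
  qed
  obtain X where X: "X \<in> carrier_mat d d" "X \<noteq> 0\<^sub>m d d" and NX: "N X = X"
    using ex_fixed_matrix[OF lin tp d] by blast
  have NX': "(N ^^ n) X = X" for n by (induction n) (auto simp: NX)
  \<comment> \<open>The orbit of the fixed matrix is constant, so it anchors the moving orbit of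
    \<sigma>.\<close>
  have limX: "(\<lambda>n. X $$ (i, j) - mat_trace X * (N ^^ n) \<sigma> $$ (i, j)) \<longlonglongrightarrow> 0" if "i < d" "j < d" for i j
  proof -
    have "(\<lambda>n. (N ^^ n) X $$ (i, j) - mat_trace X * (N ^^ n) \<sigma> $$ (i, j)) \<longlonglongrightarrow> 0"
      by (rule funpow_asymptotics[OF lin d _ that X(1)]) (rule lim[OF _ that])
    then show ?thesis by (simp add: NX')
  qed
  \<comment> \<open>With trace zero the null sequence above would be the constant entry of
    \<open>X\<close>, contradicting that \<open>X\<close> is nonzero.\<close>
  have trX: "mat_trace X \<noteq> 0"
  proof
    assume "mat_trace X = 0"
    then have "X = 0\<^sub>m d d" using limX X by (intro eq_matI) (auto simp: LIMSEQ_const_iff)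
    then show False using X by simp
  qed
  define \<omega> where "\<omega> = (1 / mat_trace X) \<cdot>\<^sub>m X"
  have \<omega>c: "\<omega> \<in> carrier_mat d d" using X by (simp add: \<omega>_def)
  have lim\<sigma>: "(\<lambda>n. (N ^^ n) \<sigma> $$ (i, j)) \<longlonglongrightarrow> \<omega> $$ (i, j)" if ij: "i < d" "j < d" for i j
  proof -
    \<comment> \<open>Each term is the entry of \<open>(N ^^ n) \<sigma>\<close>, written as the
      entry of \<omega> minus a multiple of the null sequence.\<close>
    have "(\<lambda>n. X $$ (i, j) / mat_trace X - (X $$ (i, j) - mat_trace X * (N ^^ n) \<sigma> $$ (i, j)) / mat_trace X)
        \<longlonglongrightarrow> X $$ (i, j) / mat_trace X - 0 / mat_trace X"
      by (intro tendsto_intros limX ij trX)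
    then show ?thesis using trX X ij by (simp add: \<omega>_def diff_divide_distrib)
  qed
  have lim\<rho>: "(\<lambda>n. (N ^^ n) \<rho> $$ (i, j)) \<longlonglongrightarrow> \<omega> $$ (i, j)" if "state d \<rho>" "i < d" "j < d" for \<rho> i j
    using tendsto_add[OF lim[OF that] lim\<sigma>[OF that(2,3)]] by simp
  have "psd d \<omega>"
    using psd_limit[of d "\<lambda>n. (N ^^ n) \<sigma>", OF _ \<omega>c lim\<sigma>] channel_funpow_state[OF N \<sigma>] by (auto simp: state_def)
  moreover have "mat_trace \<omega> = 1" using trX by (simp add: \<omega>_def mat_trace_smult[OF X(1)])
  ultimately have \<omega>: "state d \<omega>" by (simp add: state_def)
  have "N \<omega> = \<omega>" by (simp add: \<omega>_def superop_smult[OF lin X(1)] NX)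
  \<comment> \<open>The orbit of a fixed state is constant, yet it converges to \<omega>.\<close>
  moreover have "\<omega>' = \<omega>" if "state d \<omega>'" "N \<omega>' = \<omega>'" for \<omega>'
  proof -
    have "(N ^^ n) \<omega>' = \<omega>'" for n by (induction n) (auto simp: that)
    then show ?thesis using lim\<rho>[OF that(1)] state_carrier[OF that(1)] \<omega>c
      by (intro eq_matI) (auto simp: LIMSEQ_const_iff)
  qed
  moreover have "(\<lambda>n. trace_norm ((N ^^ n) \<rho> - \<omega>)) \<longlonglongrightarrow> 0" if \<rho>: "state d \<rho>" for \<rho>
  proof -
    have "(\<lambda>n. trace_norm ((N ^^ n) \<rho> - \<omega>)) \<longlonglongrightarrow> trace_norm (0\<^sub>m d d)"
    proof (rule tendsto_trace_norm[OF minus_carrier_mat[OF \<omega>c] zero_carrier_mat])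
      fix i j assume ij: "i < d" "j < d"
      show "(\<lambda>n. ((N ^^ n) \<rho> - \<omega>) $$ (i, j)) \<longlonglongrightarrow> 0\<^sub>m d d $$ (i, j)"
        using LIM_zero[OF lim\<rho>[OF \<rho> ij]] \<omega>c ij by simp
    qed
    then show ?thesis by simp
  qed
  ultimately show ?thesis
    unfolding mixing_def unique_fixed_state_def by (intro exI[of _ \<omega>]) (blast intro: \<omega>)
qed

theorem mainTheorem16:
  fixes d :: nat and N :: "complex mat \<Rightarrow> complex mat"
  assumes "d > 0" and "quantum_channel d N"
  shows "(mixing d N \<longleftrightarrow> replacing d N) \<and>
    (\<forall>P :: (complex mat \<Rightarrow> complex mat) \<Rightarrow> bool.
       (\<forall>M. quantum_channel d M \<longrightarrow> replacing d M \<longrightarrow> P M) \<longrightarrow>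
       (\<forall>M. quantum_channel d M \<longrightarrow> P M \<longrightarrow> mixing d M) \<longrightarrow>
       (P N \<longleftrightarrow> mixing d N) \<and> (P N \<longleftrightarrow> replacing d N)) \<and>
    (replacing d N \<longrightarrow> decoupling d N) \<and>
    (decoupling d N \<longrightarrow> mixing d N) \<and>
    (decoupling d N \<longleftrightarrow> mixing d N) \<and>
    (decoupling d N \<longleftrightarrow> replacing d N)"
proof -
  \<comment> \<open>Replacing reaches decoupling through mixing. An arbitrary \<open>P\<close> lies
    between replacing and mixing, which are equivalent, so its two hypotheses taken at
    \<open>N\<close> suffice.\<close>
  note mixing_imp_replacing[OF assms(2,1)] replacing_imp_mixing[OF assms(2,1)]
    mixing_imp_decoupling[OF assms(2,1)] decoupling_imp_mixing[OF assms(2)]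
  then show ?thesis using assms(2) by blast
qed

end
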